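(* Let $k_2\in L^2([0,1]^2)$ be a real kernel, let $K$ be the operator on $L^2([0,1])$ given by $Kf(t)=\int_0^1k_2(t,\tau)f(\tau)\,d\tau$, and assume that $I+K$ is unitary on $L^2([0,1])$, i.e. $(I+K)(I+K)^*=(I+K)^*(I+K)=I$. Let $T$ be the ($\mu$-preserving) transformation of the Wiener space defined by $$(Tw)_t=w_t+\int_0^t\left(\int_0^1k_2(s,\eta)\,dw_s\right)d\eta,\qquad t\in[0,1].$$ Then $T$ is not ergodic.
   Context: $\mu$ is the Wiener measure on $C_0([0,1])$, the space of real continuous functions on $[0,1]$ vanishing at $0$; $w=(w_t)_{t\in[0,1]}$ is the coordinate (standard Wiener) process, and the inner $dw_s$-integral is a Wiener integral. $L^2([0,1])$ is the real $L^2$ space. $T$ is ergodic if every measurable $F$ with $F\circ T=F$ $\mu$-a.s. is $\mu$-a.s. constant. *)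

theory Defs
  imports "HOL-Probability.Probability"
begin

section \<open>Square-integrable functions and operators on the unit interval\<close>

abbreviation leb01 :: "real measure"
  where "leb01 \<equiv> restrict_space lborel {0..1}"

text \<open>
  Elements of \<open>L\<^sup>2([0,1])\<close> are represented by Borel functions; identities between elements
  of \<open>L\<^sup>2([0,1])\<close> are accordingly stated almost everywhere.
\<close>

definition L2_01 :: "(real \<Rightarrow> real) set"
  where "L2_01 = {f \<in> borel_measurable leb01. integrable leb01 (\<lambda>x. (f x)\<^sup>2)}"

definition inner_01 :: "(real \<Rightarrow> real) \<Rightarrow> (real \<Rightarrow> real) \<Rightarrow> real"
  where "inner_01 f g = (\<integral>x. f x * g x \<partial>leb01)"

definition L2_kernel :: "(real \<Rightarrow> real \<Rightarrow> real) \<Rightarrow> bool"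
  where "L2_kernel k \<longleftrightarrow>
    (\<lambda>(t, \<tau>). k t \<tau>) \<in> borel_measurable (leb01 \<Otimes>\<^sub>M leb01) \<and>
    integrable (leb01 \<Otimes>\<^sub>M leb01) (\<lambda>(t, \<tau>). (k t \<tau>)\<^sup>2)"

definition kernel_op :: "(real \<Rightarrow> real \<Rightarrow> real) \<Rightarrow> (real \<Rightarrow> real) \<Rightarrow> real \<Rightarrow> real"
  where "kernel_op k f t = (\<integral>\<tau>. k t \<tau> * f \<tau> \<partial>leb01)"

definition adjoint_01 ::
    "((real \<Rightarrow> real) \<Rightarrow> real \<Rightarrow> real) \<Rightarrow> ((real \<Rightarrow> real) \<Rightarrow> real \<Rightarrow> real) \<Rightarrow> bool"
  where "adjoint_01 A B \<longleftrightarrow>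
    (\<forall>g\<in>L2_01. B g \<in> L2_01) \<and>
    (\<forall>f\<in>L2_01. \<forall>g\<in>L2_01. inner_01 (A f) g = inner_01 f (B g))"

text \<open>
  The adjoint of a bounded operator exists and is unique up to null sets, so the existential
  quantifier below only gives it a name.
\<close>

definition unitary_01 :: "((real \<Rightarrow> real) \<Rightarrow> real \<Rightarrow> real) \<Rightarrow> bool"
  where "unitary_01 A \<longleftrightarrow>
    (\<forall>f\<in>L2_01. A f \<in> L2_01) \<and>
    (\<exists>B. adjoint_01 A B \<and>
      (\<forall>f\<in>L2_01. (AE x in leb01. A (B f) x = f x) \<and> (AE x in leb01. B (A f) x = f x)))"

section \<open>Wiener space\<close>

text \<open>
  Paths are made \<^const>\<open>extensional\<close> so that each element of \<open>C\<^sub>0([0,1])\<close> is represented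
  by exactly one function on the reals.
\<close>

definition C0_01 :: "(real \<Rightarrow> real) set"
  where "C0_01 = {w \<in> extensional {0..1}. continuous_on {0..1} w \<and> w 0 = 0}"

text \<open>
  The \<open>\<sigma>\<close>-algebra generated by the coordinate maps is the trace of the product
  \<open>\<sigma>\<close>-algebra; on \<open>C\<^sub>0([0,1])\<close> it is the Borel \<open>\<sigma>\<close>-algebra of the uniform norm.
\<close>

locale wiener_measure = prob_space \<mu> for \<mu> :: "(real \<Rightarrow> real) measure" +
  assumes sets_wiener: "sets \<mu> = sets (restrict_space (\<Pi>\<^sub>M t\<in>{0..1}. borel) C0_01)"
    and normal_increments:
      "\<And>s t. 0 \<le> s \<Longrightarrow> s < t \<Longrightarrow> t \<le> 1 \<Longrightarrow>
        distributed \<mu> lborel (\<lambda>w. w t - w s) (normal_density 0 (sqrt (t - s)))"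
    and indep_increments:
      "\<And>(n::nat) t. 0 \<le> t 0 \<Longrightarrow> t n \<le> 1 \<Longrightarrow> (\<And>i. i < n \<Longrightarrow> t i < t (Suc i)) \<Longrightarrow>
        indep_vars (\<lambda>_. borel) (\<lambda>i w. w (t (Suc i)) - w (t i)) {..<n}"

section \<open>The Wiener integral\<close>

definition partition_01 :: "nat \<Rightarrow> (nat \<Rightarrow> real) \<Rightarrow> bool"
  where "partition_01 n t \<longleftrightarrow> 0 \<le> t 0 \<and> t n \<le> 1 \<and> (\<forall>i<n. t i \<le> t (Suc i))"

definition step_fun :: "nat \<Rightarrow> (nat \<Rightarrow> real) \<Rightarrow> (nat \<Rightarrow> real) \<Rightarrow> real \<Rightarrow> real"
  where "step_fun n t c s = (\<Sum>i<n. c i * indicator {t i<..t (Suc i)} s)"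

definition step_integral :: "nat \<Rightarrow> (nat \<Rightarrow> real) \<Rightarrow> (nat \<Rightarrow> real) \<Rightarrow> (real \<Rightarrow> real) \<Rightarrow> real"
  where "step_integral n t c w = (\<Sum>i<n. c i * (w (t (Suc i)) - w (t i)))"

text \<open>
  \<open>is_wiener_integral \<mu> f X\<close>: the random variable \<open>X\<close> is a version of
  \<open>\<integral>\<^sub>0\<^sup>1 f(s) dw\<^sub>s\<close>, the \<open>L\<^sup>2(\<mu>)\<close>-limit of the integrals of step functions converging
  to \<open>f\<close> in \<open>L\<^sup>2([0,1])\<close>.
\<close>

definition is_wiener_integral ::
    "(real \<Rightarrow> real) measure \<Rightarrow> (real \<Rightarrow> real) \<Rightarrow> ((real \<Rightarrow> real) \<Rightarrow> real) \<Rightarrow> bool"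
  where "is_wiener_integral \<mu> f X \<longleftrightarrow>
    f \<in> L2_01 \<and> X \<in> borel_measurable \<mu> \<and>
    (\<exists>n t c. (\<forall>m. partition_01 (n m) (t m)) \<and>
      (\<lambda>m. \<integral>\<^sup>+s. ennreal ((f s - step_fun (n m) (t m) (c m) s)\<^sup>2) \<partial>leb01) \<longlonglongrightarrow> 0 \<and>
      (\<lambda>m. \<integral>\<^sup>+w. ennreal ((X w - step_integral (n m) (t m) (c m) w)\<^sup>2) \<partial>\<mu>) \<longlonglongrightarrow> 0)"

text \<open>
  The Wiener integral is only determined up to null sets for each parameter value; to integrate
  \<open>\<integral>\<^sub>0\<^sup>1 k(s,\<eta>) dw\<^sub>s\<close> in \<open>\<eta>\<close> one takes a jointly measurable version \<open>\<Phi> w \<eta>\<close>.  By the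
  isometry \<open>\<integral>\<integral> (\<Phi> w \<eta>)\<^sup>2 d\<eta> \<mu>(dw)\<close> equals the squared \<open>L\<^sup>2\<close>-norm of \<open>k\<close>, so
  almost every path of \<open>\<Phi>\<close> is integrable on \<open>[0,1]\<close>, and the resulting \<open>T\<close> is unique up to
  \<open>\<mu>\<close>-null sets.
\<close>

definition wiener_transformation ::
    "(real \<Rightarrow> real) measure \<Rightarrow> (real \<Rightarrow> real \<Rightarrow> real) \<Rightarrow> ((real \<Rightarrow> real) \<Rightarrow> real \<Rightarrow> real) \<Rightarrow> bool"
  where "wiener_transformation \<mu> k T \<longleftrightarrow>
    T \<in> \<mu> \<rightarrow>\<^sub>M \<mu> \<and>
    (\<exists>\<Phi>. (\<lambda>(w, \<eta>). \<Phi> w \<eta>) \<in> borel_measurable (\<mu> \<Otimes>\<^sub>M leb01) \<and>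
      (AE \<eta> in leb01. is_wiener_integral \<mu> (\<lambda>s. k s \<eta>) (\<lambda>w. \<Phi> w \<eta>)) \<and>
      (AE w in \<mu>. \<forall>t\<in>{0..1}. T w t = w t + (LINT \<eta>:{0..t}|lborel. \<Phi> w \<eta>)))"

section \<open>Ergodicity\<close>

definition ergodic :: "'a measure \<Rightarrow> ('a \<Rightarrow> 'a) \<Rightarrow> bool"
  where "ergodic M T \<longleftrightarrow>
    (\<forall>F::'a \<Rightarrow> real. F \<in> borel_measurable M \<longrightarrow> (AE x in M. F (T x) = F x) \<longrightarrow>
      (\<exists>c. AE x in M. F x = c))"

end

(*
  Write Phi_eta(w) for the integral of k(s,eta) dw_s, so that Tw - w has density Phi(w). Integrating
  step functions against d(Tw)_s = dw_s + Phi_s(w) ds and passing to the limit gives, for almost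
  every w,
    Phi_eta(Tw) = Phi_eta(w) + (integral of k(s,eta) Phi_s(w) ds),
  that is, Phi(Tw) = (I+K)^* Phi(w). As (I+K)^* is an isometry, F(w) = |Phi(w)|^2 in L^2([0,1]) is
  T-invariant. Now X = (Tw - w)(1), the integral of Phi_eta over [0,1], is a centred Gaussian
  variable with X^2 <= F. If X is nondegenerate, then F is essentially unbounded, hence not
  constant. If X = 0, then w(1) is invariant, and it is not constant.
*)

theory Submission
  imports Defs
begin

text \<open>The obstacle is that Phi_eta is fixed only up to null sets, whereas the argument
  evaluates it at Tw; composing with T respects such versions only if preimages of null sets are
  null. The shift is therefore computed for step kernels h_n(s,eta), finite combinations of
  indicators of (0,p] in s with bounded measurable coefficients in eta. Their integrals Psi_n are
  linear combinations of point evaluations, so that Psi_n(Tw) = Psi_n(w) + (integral of h_n(s,eta)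
  Phi_s(w) ds) is an exact identity wherever the formula for Tw holds with an integrable density.
  Convergence at Tw is then inferred from convergence at w, along a subsequence chosen independently
  of w, and the Hilbert-Schmidt norm of h_n - k controls the remaining term. The variable X is the
  Wiener integral of K1. It vanishes exactly when K1 = 0, for example when k = 0 and T is the
  identity, and then the bound X^2 <= F says nothing; hence the second invariant functional
  w(1).\<close>

section \<open>Elementary Wiener integrals\<close>

text \<open>
  Step functions are written in terms of the intervals \<open>(0,p]\<close> only, so that, paths vanishing
  at \<open>0\<close>, the elementary integral is a linear combination of point evaluations.
\<close>

definition elem_fun :: "real set \<Rightarrow> (real \<Rightarrow> real) \<Rightarrow> real \<Rightarrow> real"
  where "elem_fun P c s = (\<Sum>p\<in>P. c p * indicator {0<..p} s)"

definition elem_int :: "real set \<Rightarrow> (real \<Rightarrow> real) \<Rightarrow> (real \<Rightarrow> real) \<Rightarrow> real"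
  where "elem_int P c w = (\<Sum>p\<in>P. c p * w p)"

lemma sum_Un_extend:
  fixes c d g :: "'a \<Rightarrow> real"
  assumes "finite P" "finite Q"
  shows "(\<Sum>p\<in>P \<union> Q. ((if p \<in> P then c p else 0) + (if p \<in> Q then d p else 0)) * g p)
    = (\<Sum>p\<in>P. c p * g p) + (\<Sum>p\<in>Q. d p * g p)"
proof -
  have "(\<Sum>p\<in>P \<union> Q. (if p \<in> P then c p else 0) * g p) = (\<Sum>p\<in>P. c p * g p)"
    by (rule sum.mono_neutral_cong_right) (use assms in auto)
  moreover have "(\<Sum>p\<in>P \<union> Q. (if p \<in> Q then d p else 0) * g p) = (\<Sum>p\<in>Q. d p * g p)"
    by (rule sum.mono_neutral_cong_right) (use assms in auto)
  ultimately show ?thesis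
    by (simp add: distrib_right sum.distrib)
qed

text \<open>Extending both coefficient functions by zero to the union takes care of coinciding
  points. Sums, and after a change of sign differences, stay elementary without any common ordered
  refinement of the two point sets.\<close>

lemma elem_add:
  fixes c d :: "real \<Rightarrow> real"
  assumes "finite P" "finite Q"
  defines "e \<equiv> \<lambda>p. (if p \<in> P then c p else 0) + (if p \<in> Q then d p else 0)"
  shows "elem_fun (P \<union> Q) e s = elem_fun P c s + elem_fun Q d s"
    and "elem_int (P \<union> Q) e w = elem_int P c w + elem_int Q d w"
  unfolding elem_fun_def elem_int_def e_def by (rule sum_Un_extend[OF assms(1,2)])+

lemma elem_singleton: "elem_fun {p} c s = c p * indicator {0<..p} s" "elem_int {p} c w = c p * w p"
  unfolding elem_fun_def elem_int_def by (simp_all del: sum_mult_indicator sum_indicator_mult)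

lemma partition_01_range:
  assumes "partition_01 n t" "i \<le> n"
  shows "t i \<in> {0..1}"
proof -
  have "t 0 \<le> t i"
    using assms(2)
  proof (induction i)
    case (Suc i)
    then have "t i \<le> t (Suc i)" using assms(1) by (simp add: partition_01_def)
    with Suc show ?case by simp
  qed simp
  moreover have "t i \<le> t n"
    using assms(2)
  proof (induction rule: inc_induct)
    case (step k)
    then have "t k \<le> t (Suc k)" using assms(1) by (simp add: partition_01_def)
    with step show ?case by simp
  qed simp
  ultimately show ?thesis
    using assms(1) by (auto simp: partition_01_def)
qed

text \<open>A step on (a,b] is the step on (0,b] minus the step on (0,a], so each interval adds at
  most two points to the index set. This is the bridge from partitions, as in
  \<open>is_wiener_integral\<close>, to unordered point sets.\<close>

lemma step_eq_elem:
  assumes "partition_01 n t"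
  shows "\<exists>P d. finite P \<and> P \<subseteq> {0..1} \<and> (\<forall>s. step_fun n t c s = elem_fun P d s) \<and>
    (\<forall>w. step_integral n t c w = elem_int P d w)"
proof -
  have "\<exists>P d. finite P \<and> P \<subseteq> {0..1} \<and> (\<forall>s. step_fun m t c s = elem_fun P d s) \<and>
    (\<forall>w. step_integral m t c w = elem_int P d w)" if "m \<le> n" for m
    using that
  proof (induction m)
    case 0
    show ?case
      by (intro exI[of _ "{}"]) (simp add: step_fun_def step_integral_def elem_fun_def elem_int_def)
  next
    case (Suc m)
    then obtain P d where P: "finite P" "P \<subseteq> {0..1}" "\<And>s. step_fun m t c s = elem_fun P d s"
      "\<And>w. step_integral m t c w = elem_int P d w" by auto
    have le: "0 \<le> t m" "t m \<le> t (Suc m)" "t (Suc m) \<le> 1"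
      using assms Suc.prems partition_01_range[OF assms] by (auto simp: partition_01_def)
    let ?Q = "{t (Suc m)}" and ?R = "{t m}"
    have ind: "indicator {t m<..t (Suc m)} s = indicator {0<..t (Suc m)} s - (indicator {0<..t m} s :: real)" for s
      using le by (auto simp: indicator_def)
    obtain e where "\<And>s. elem_fun (P \<union> ?Q) e s = elem_fun P d s + elem_fun ?Q (\<lambda>_. c m) s"
      "\<And>w. elem_int (P \<union> ?Q) e w = elem_int P d w + elem_int ?Q (\<lambda>_. c m) w"
      using elem_add[OF P(1), of ?Q d "\<lambda>_. c m"] by blast
    moreover obtain e' where "\<And>s. elem_fun ((P \<union> ?Q) \<union> ?R) e' s = elem_fun (P \<union> ?Q) e s + elem_fun ?R (\<lambda>_. - c m) s"
      "\<And>w. elem_int ((P \<union> ?Q) \<union> ?R) e' w = elem_int (P \<union> ?Q) e w + elem_int ?R (\<lambda>_. - c m) w"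
      using elem_add[of "P \<union> ?Q" ?R e "\<lambda>_. - c m"] P(1) by blast
    ultimately have "\<forall>s. step_fun (Suc m) t c s = elem_fun ((P \<union> ?Q) \<union> ?R) e' s"
      "\<forall>w. step_integral (Suc m) t c w = elem_int ((P \<union> ?Q) \<union> ?R) e' w"
      using P(3,4) unfolding elem_singleton step_fun_def step_integral_def sum.lessThan_Suc ind
      by (auto simp del: sum_mult_indicator sum_indicator_mult simp: right_diff_distrib)
    then show ?case
      using P(1,2) le by (intro exI[of _ "(P \<union> ?Q) \<union> ?R"] exI[of _ e']) auto
  qed
  then show ?thesis by blast
qed

lemma ennreal_diff_square_le:
  fixes x y z :: real
  shows "ennreal ((x - z)\<^sup>2) \<le> 2 * ennreal ((x - y)\<^sup>2) + 2 * ennreal ((y - z)\<^sup>2)"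
proof -
  have "0 \<le> ((x - y) - (y - z))\<^sup>2" by simp
  then have "(x - z)\<^sup>2 \<le> 2 * (x - y)\<^sup>2 + 2 * (y - z)\<^sup>2"
    by (simp add: power2_eq_square algebra_simps)
  then have "ennreal ((x - z)\<^sup>2) \<le> ennreal (2 * (x - y)\<^sup>2 + 2 * (y - z)\<^sup>2)"
    by (rule ennreal_leI)
  also have "\<dots> = 2 * ennreal ((x - y)\<^sup>2) + 2 * ennreal ((y - z)\<^sup>2)"
    by (simp add: ennreal_plus ennreal_mult)
  finally show ?thesis .
qed

text \<open>A triangle inequality for squared L2 norms. The factor 2 is the price for avoiding
  square roots; with \<open>nn_integral\<close> no integrability has to be checked.\<close>

lemma nn_integral_diff_square_le:
  fixes X Y Z :: "'a \<Rightarrow> real"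
  assumes [measurable]: "X \<in> borel_measurable M" "Y \<in> borel_measurable M" "Z \<in> borel_measurable M"
  shows "(\<integral>\<^sup>+w. ennreal ((X w - Z w)\<^sup>2) \<partial>M)
    \<le> 2 * (\<integral>\<^sup>+w. ennreal ((X w - Y w)\<^sup>2) \<partial>M) + 2 * (\<integral>\<^sup>+w. ennreal ((Y w - Z w)\<^sup>2) \<partial>M)"
proof -
  have "(\<integral>\<^sup>+w. ennreal ((X w - Z w)\<^sup>2) \<partial>M)
    \<le> (\<integral>\<^sup>+w. 2 * ennreal ((X w - Y w)\<^sup>2) + 2 * ennreal ((Y w - Z w)\<^sup>2) \<partial>M)"
    by (intro nn_integral_mono ennreal_diff_square_le)
  then show ?thesis
    by (simp add: nn_integral_add nn_integral_cmult)
qed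

lemma space_leb01 [simp]: "space leb01 = {0..1}"
  by (simp add: space_restrict_space)

lemma prob_space_leb01: "prob_space leb01"
  by (rule prob_spaceI) (simp add: emeasure_restrict_space space_restrict_space)

lemma measurable_ident_leb01 [measurable]: "(\<lambda>x. x) \<in> leb01 \<rightarrow>\<^sub>M borel"
  by (rule measurable_restrict_space1) simp

lemma elem_fun_measurable [measurable]: "elem_fun P c \<in> borel_measurable leb01"
  unfolding elem_fun_def by measurable

lemma measure_leb01_Ioc:
  assumes "0 \<le> p" "p \<le> 1"
  shows "measure leb01 ({0<..p} \<inter> {0..1}) = p"
proof -
  have "{0<..p} \<inter> {0..1} = {0<..p}" "{0<..p} \<subseteq> {0..1}" using assms by auto
  then show ?thesis using assms by (simp add: measure_restrict_space)
qed

text \<open>The intervals (0,p] and (0,q] meet in (0,min p q], so the Gram matrix of their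
  indicators is \<open>min p q\<close>, which is also the covariance of Brownian motion. The
  isometry rests on this coincidence.\<close>

lemma elem_fun_square_integral:
  assumes "finite P" "P \<subseteq> {0..1}"
  shows "has_bochner_integral leb01 (\<lambda>s. (elem_fun P c s)\<^sup>2) (\<Sum>p\<in>P. \<Sum>q\<in>P. c p * c q * min p q)"
proof -
  interpret prob_space leb01 by (rule prob_space_leb01)
  have eq: "(elem_fun P c s)\<^sup>2 = (\<Sum>p\<in>P. \<Sum>q\<in>P. c p * c q * indicator ({0<..min p q} \<inter> space leb01) s)"
    if "s \<in> space leb01" for s
    unfolding elem_fun_def power2_eq_square sum_product using that
    by (intro sum.cong refl) (auto simp: indicator_def)
  have "has_bochner_integral leb01 (\<lambda>s. \<Sum>p\<in>P. \<Sum>q\<in>P. c p * c q * indicator ({0<..min p q} \<inter> space leb01) s)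
      (\<Sum>p\<in>P. \<Sum>q\<in>P. c p * c q * min p q)"
  proof (intro has_bochner_integral_sum has_bochner_integral_mult_right)
    fix p q assume "p \<in> P" "q \<in> P"
    then have "0 \<le> min p q" "min p q \<le> 1" using assms by (auto simp: min_le_iff_disj)
    from measure_leb01_Ioc[OF this]
    have "min p q = measure leb01 ({0<..min p q} \<inter> space leb01)" by simp
    moreover have "has_bochner_integral leb01 (indicator ({0<..min p q} \<inter> space leb01)) (measure leb01 ({0<..min p q} \<inter> space leb01))"
      by (intro has_bochner_integral_real_indicator)
         (auto simp: sets_restrict_space less_top[symmetric])
    ultimately show "has_bochner_integral leb01 (indicator ({0<..min p q} \<inter> space leb01)) (min p q)"
      by simp
  qed
  moreover have "has_bochner_integral leb01 (\<lambda>s. (elem_fun P c s)\<^sup>2) (\<Sum>p\<in>P. \<Sum>q\<in>P. c p * c q * min p q)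
    \<longleftrightarrow> has_bochner_integral leb01 (\<lambda>s. \<Sum>p\<in>P. \<Sum>q\<in>P. c p * c q * indicator ({0<..min p q} \<inter> space leb01) s)
      (\<Sum>p\<in>P. \<Sum>q\<in>P. c p * c q * min p q)"
    by (intro has_bochner_integral_cong refl eq)
  ultimately show ?thesis by blast
qed

section \<open>The isometry between step functions and their Wiener integrals\<close>

context wiener_measure begin

lemma space_wiener: "space \<mu> = C0_01"
proof -
  have "space \<mu> = space (restrict_space (\<Pi>\<^sub>M t\<in>{0..1}. borel) C0_01)"
    by (rule sets_eq_imp_space_eq[OF sets_wiener])
  then show ?thesis by (auto simp: space_restrict_space space_PiM C0_01_def extensional_def PiE_def)
qed

lemma at_0: "w \<in> space \<mu> \<Longrightarrow> w 0 = 0"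
  by (simp add: space_wiener C0_01_def)

lemma eval_measurable [measurable]:
  assumes "t \<in> {0..1}" shows "(\<lambda>w. w t) \<in> borel_measurable \<mu>"
proof -
  have "(\<lambda>w. w t) \<in> borel_measurable (restrict_space (\<Pi>\<^sub>M t\<in>{0..1}. borel) C0_01)"
    using assms by (intro measurable_restrict_space1 measurable_component_singleton)
  then show ?thesis
    using measurable_cong_sets[OF sets_wiener refl] by blast
qed

lemma elem_int_measurable [measurable]:
  assumes "P \<subseteq> {0..1}" shows "elem_int P c \<in> borel_measurable \<mu>"
  unfolding elem_int_def using assms by (intro borel_measurable_sum borel_measurable_times) auto

lemma increment_std_normal:
  assumes "0 \<le> s" "s < t" "t \<le> 1"
  shows "distr \<mu> borel (\<lambda>w. (w t - w s) / sqrt (t - s)) = std_normal_distribution"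
proof -
  have "distributed \<mu> lborel (\<lambda>w. (w t - w s - 0) / sqrt (t - s)) std_normal_density"
    using normal_increments[OF assms] assms by (subst normal_standard_normal_convert[symmetric]) auto
  then show ?thesis
    by (auto simp: distributed_def cong: distr_cong)
qed

lemma char_increment:
  assumes "0 \<le> s" "s < t" "t \<le> 1"
  shows "char (distr \<mu> borel (\<lambda>w. c * (w t - w s))) u = exp (- u\<^sup>2 * (c\<^sup>2 * (t - s)) / 2)"
proof -
  have [measurable]: "(\<lambda>w. w t) \<in> borel_measurable \<mu>" "(\<lambda>w. w s) \<in> borel_measurable \<mu>"
    using assms by auto
  have "char (distr \<mu> borel (\<lambda>w. c * (w t - w s))) u
    = char (distr \<mu> borel (\<lambda>w. (w t - w s) / sqrt (t - s))) (u * c * sqrt (t - s))"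
    using assms by (simp add: char_def integral_distr mult.assoc)
  also have "\<dots> = exp (- (u * c * sqrt (t - s))\<^sup>2 / 2)"
    unfolding increment_std_normal[OF assms] char_std_normal_distribution by simp
  also have "\<dots> = exp (- u\<^sup>2 * (c\<^sup>2 * (t - s)) / 2)"
    using assms by (simp add: power_mult_distrib mult.assoc)
  finally show ?thesis .
qed

lemma increment_square:
  assumes "0 \<le> s" "s \<le> t" "t \<le> 1"
  shows "has_bochner_integral \<mu> (\<lambda>w. (w t - w s)\<^sup>2) (t - s)"
proof (cases "s = t")
  case True then show ?thesis by (simp add: has_bochner_integral_zero)
next
  case False
  with assms have st: "0 \<le> s" "s < t" "t \<le> 1" by auto
  note D = normal_increments[OF st]
  \<comment> \<open>The moment formula of order 2k at k = 1: 2! / ((2 / sigma^2) * 1!) = sigma^2,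
    with sigma^2 = t - s.\<close>
  have "has_bochner_integral lborel (\<lambda>x. normal_density 0 (sqrt (t - s)) x * (x - 0) ^ (2 * 1))
      (fact (2 * 1) / ((2 / (sqrt (t - s))\<^sup>2) ^ 1 * fact 1))"
    using st by (intro normal_moment_even) auto
  then have *: "has_bochner_integral lborel (\<lambda>x. normal_density 0 (sqrt (t - s)) x * x\<^sup>2) (t - s)"
    using st by (simp add: diff_divide_distrib)
  show ?thesis
    using * distributed_integrable[OF D, of "\<lambda>x. x\<^sup>2"] distributed_integral[OF D, of "\<lambda>x. x\<^sup>2"]
    by (auto simp: has_bochner_integral_iff)
qed

text \<open>Polarisation: 2 w(p) w(q) = w(p)^2 + w(q)^2 - (w(q) - w(p))^2, so the covariance follows
  from the variances of three increments.\<close>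

lemma covariance_min:
  assumes "p \<in> {0..1}" "q \<in> {0..1}"
  shows "has_bochner_integral \<mu> (\<lambda>w. w p * w q) (min p q)"
proof -
  have *: "has_bochner_integral \<mu> (\<lambda>w. w p * w q) p" if "0 \<le> p" "p \<le> q" "q \<le> 1" for p q
  proof -
    have "has_bochner_integral \<mu> (\<lambda>w. ((w p - w 0)\<^sup>2 + (w q - w 0)\<^sup>2 - (w q - w p)\<^sup>2) / 2)
       (((p - 0) + (q - 0) - (q - p)) / 2)"
      using that by (intro has_bochner_integral_divide_zero has_bochner_integral_diff has_bochner_integral_add increment_square) auto
    moreover have "((w p - w 0)\<^sup>2 + (w q - w 0)\<^sup>2 - (w q - w p)\<^sup>2) / 2 = w p * w q" if "w \<in> space \<mu>" for w
      using at_0[OF that] by (simp add: power2_eq_square algebra_simps)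
    ultimately show ?thesis
      by (simp cong: has_bochner_integral_cong)
  qed
  show ?thesis
    using *[of p q] *[of q p] assms by (cases "p \<le> q") (auto simp: mult.commute min_def)
qed

lemma elem_int_square_integral:
  assumes "finite P" "P \<subseteq> {0..1}"
  shows "has_bochner_integral \<mu> (\<lambda>w. (elem_int P c w)\<^sup>2) (\<Sum>p\<in>P. \<Sum>q\<in>P. c p * c q * min p q)"
proof -
  have "has_bochner_integral \<mu> (\<lambda>w. \<Sum>p\<in>P. \<Sum>q\<in>P. c p * c q * (w p * w q)) (\<Sum>p\<in>P. \<Sum>q\<in>P. c p * c q * min p q)"
    using assms by (intro has_bochner_integral_sum has_bochner_integral_mult_right covariance_min) auto
  moreover have "(elem_int P c w)\<^sup>2 = (\<Sum>p\<in>P. \<Sum>q\<in>P. c p * c q * (w p * w q))" for w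
    unfolding elem_int_def power2_eq_square sum_product by (intro sum.cong refl) simp
  ultimately show ?thesis by simp
qed

lemma elem_isometry:
  assumes "finite P" "P \<subseteq> {0..1}"
  shows "(\<integral>\<^sup>+w. ennreal ((elem_int P c w)\<^sup>2) \<partial>\<mu>) = (\<integral>\<^sup>+s. ennreal ((elem_fun P c s)\<^sup>2) \<partial>leb01)"
proof -
  let ?v = "\<Sum>p\<in>P. \<Sum>q\<in>P. c p * c q * min p q"
  have "(\<integral>\<^sup>+w. ennreal ((elem_int P c w)\<^sup>2) \<partial>\<mu>) = ennreal ?v"
    using elem_int_square_integral[OF assms, of c]
    by (subst nn_integral_eq_integral) (auto simp: has_bochner_integral_iff)
  moreover have "(\<integral>\<^sup>+s. ennreal ((elem_fun P c s)\<^sup>2) \<partial>leb01) = ennreal ?v"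
    using elem_fun_square_integral[OF assms, of c]
    by (subst nn_integral_eq_integral) (auto simp: has_bochner_integral_iff)
  ultimately show ?thesis by simp
qed

lemma elem_diff_isometry:
  assumes "finite P" "P \<subseteq> {0..1}" "finite Q" "Q \<subseteq> {0..1}"
  shows "(\<integral>\<^sup>+w. ennreal ((elem_int P c w - elem_int Q d w)\<^sup>2) \<partial>\<mu>)
    = (\<integral>\<^sup>+s. ennreal ((elem_fun P c s - elem_fun Q d s)\<^sup>2) \<partial>leb01)"
proof -
  have neg: "elem_int Q (\<lambda>p. - d p) w = - elem_int Q d w" "elem_fun Q (\<lambda>p. - d p) s = - elem_fun Q d s" for w s
    by (simp_all add: elem_int_def elem_fun_def sum_negf)
  show ?thesis
    using elem_isometry[of "P \<union> Q" "\<lambda>p. (if p \<in> P then c p else 0) + (if p \<in> Q then - d p else 0)"]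
    unfolding elem_add[OF assms(1,3)] neg using assms by simp
qed

text \<open>\<open>is_wiener_integral\<close> supplies just one approximating sequence; this
  compares \<open>X\<close> with an arbitrary elementary integral. The comparison passes through the
  m-th approximation twice, once on path space and once, after the isometry, on [0,1]; each passage
  costs a factor 2. The constant 4 instead of 1 is harmless, as the right side is later made to tend
  to 0.\<close>

lemma is_wiener_integral_elem_le:
  assumes "is_wiener_integral \<mu> f X" and P: "finite P" "P \<subseteq> {0..1}"
  shows "(\<integral>\<^sup>+w. ennreal ((X w - elem_int P c w)\<^sup>2) \<partial>\<mu>) \<le> 4 * (\<integral>\<^sup>+s. ennreal ((f s - elem_fun P c s)\<^sup>2) \<partial>leb01)"
    (is "?L \<le> 4 * ?R")
proof -
  from assms(1) obtain n t d where part: "\<And>m. partition_01 (n m) (t m)"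
    and limf: "(\<lambda>m. \<integral>\<^sup>+s. ennreal ((f s - step_fun (n m) (t m) (d m) s)\<^sup>2) \<partial>leb01) \<longlonglongrightarrow> 0"
    and limX: "(\<lambda>m. \<integral>\<^sup>+w. ennreal ((X w - step_integral (n m) (t m) (d m) w)\<^sup>2) \<partial>\<mu>) \<longlonglongrightarrow> 0"
    and [measurable]: "X \<in> borel_measurable \<mu>" "f \<in> borel_measurable leb01"
    unfolding is_wiener_integral_def L2_01_def by blast
  have "\<forall>m. \<exists>P e. finite P \<and> P \<subseteq> {0..1} \<and> (\<forall>s. step_fun (n m) (t m) (d m) s = elem_fun P e s) \<and>
    (\<forall>w. step_integral (n m) (t m) (d m) w = elem_int P e w)"
    using step_eq_elem[OF part] by blast
  then obtain Q e where Q: "\<And>m. finite (Q m)" "\<And>m. Q m \<subseteq> {0..1}"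
    and eqf: "\<And>m s. step_fun (n m) (t m) (d m) s = elem_fun (Q m) (e m) s"
    and eqX: "\<And>m w. step_integral (n m) (t m) (d m) w = elem_int (Q m) (e m) w"
    unfolding choice_iff by blast
  have [measurable]: "elem_int P c \<in> borel_measurable \<mu>" "\<And>m. elem_int (Q m) (e m) \<in> borel_measurable \<mu>"
    using P Q by auto
  define A where "A m = (\<integral>\<^sup>+s. ennreal ((f s - elem_fun (Q m) (e m) s)\<^sup>2) \<partial>leb01)" for m
  define B where "B m = (\<integral>\<^sup>+w. ennreal ((X w - elem_int (Q m) (e m) w)\<^sup>2) \<partial>\<mu>)" for m
  have A: "A \<longlonglongrightarrow> 0" using limf unfolding A_def eqf .
  have "B m = (\<integral>\<^sup>+w. ennreal ((X w - step_integral (n m) (t m) (d m) w)\<^sup>2) \<partial>\<mu>)" for m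
    unfolding B_def by (intro nn_integral_cong) (simp add: eqX)
  then have B: "B \<longlonglongrightarrow> 0" using limX by presburger
  have "?L \<le> 2 * B m + 2 * (2 * A m + 2 * ?R)" for m
  proof -
    have "?L \<le> 2 * B m + 2 * (\<integral>\<^sup>+w. ennreal ((elem_int (Q m) (e m) w - elem_int P c w)\<^sup>2) \<partial>\<mu>)"
      unfolding B_def by (rule nn_integral_diff_square_le) auto
    also have "(\<integral>\<^sup>+w. ennreal ((elem_int (Q m) (e m) w - elem_int P c w)\<^sup>2) \<partial>\<mu>)
       = (\<integral>\<^sup>+s. ennreal ((elem_fun (Q m) (e m) s - elem_fun P c s)\<^sup>2) \<partial>leb01)"
      using P Q by (intro elem_diff_isometry)
    also have "\<dots> \<le> 2 * (\<integral>\<^sup>+s. ennreal ((elem_fun (Q m) (e m) s - f s)\<^sup>2) \<partial>leb01) + 2 * ?R"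
      by (rule nn_integral_diff_square_le) auto
    also have "(\<integral>\<^sup>+s. ennreal ((elem_fun (Q m) (e m) s - f s)\<^sup>2) \<partial>leb01) = A m"
      unfolding A_def by (simp add: power2_commute)
    finally show ?thesis by (simp add: add_left_mono mult_left_mono)
  qed
  moreover have "(\<lambda>m. 2 * B m + 2 * (2 * A m + 2 * ?R)) \<longlonglongrightarrow> 2 * 0 + 2 * (2 * 0 + 2 * ?R)"
    by (intro tendsto_intros A B ennreal_tendsto_cmult) auto
  ultimately have "?L \<le> 2 * 0 + 2 * (2 * 0 + 2 * ?R)"
    by (intro LIMSEQ_le_const[where X="\<lambda>m. 2 * B m + 2 * (2 * A m + 2 * ?R)"]) auto
  also have "\<dots> = 4 * ?R" by (simp flip: mult.assoc)
  finally show ?thesis .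
qed

end

section \<open>Gaussian limits\<close>

lemma integrable_mult_square:
  fixes f g :: "'a \<Rightarrow> real"
  assumes [measurable]: "f \<in> borel_measurable M" "g \<in> borel_measurable M"
    and "integrable M (\<lambda>x. (f x)\<^sup>2)" "integrable M (\<lambda>x. (g x)\<^sup>2)"
  shows "integrable M (\<lambda>x. f x * g x)"
proof (rule Bochner_Integration.integrable_bound)
  show "integrable M (\<lambda>x. (f x)\<^sup>2 + (g x)\<^sup>2)" using assms by simp
  show "AE x in M. norm (f x * g x) \<le> norm ((f x)\<^sup>2 + (g x)\<^sup>2)"
  proof (rule AE_I2)
    fix x
    have "2 * \<bar>f x * g x\<bar> \<le> (f x)\<^sup>2 + (g x)\<^sup>2"
      using sum_squares_bound[of "\<bar>f x\<bar>" "\<bar>g x\<bar>"] by (simp add: abs_mult)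
    then show "norm (f x * g x) \<le> norm ((f x)\<^sup>2 + (g x)\<^sup>2)" by simp
  qed
qed simp

text \<open>Expanding g^2 - f^2 = 2 f (g - f) + (g - f)^2 leaves a cross term, which is split by
  2|ab| <= e a^2 + b^2 / e with a weight e that depends on n.\<close>

lemma L2_norm_tendsto:
  fixes f :: "'a \<Rightarrow> real"
  assumes [measurable]: "f \<in> borel_measurable M" "\<And>n. g n \<in> borel_measurable M"
    and f: "integrable M (\<lambda>x. (f x)\<^sup>2)"
    and d: "\<And>n. integrable M (\<lambda>x. (g n x - f x)\<^sup>2)"
    and lim: "(\<lambda>n::nat. \<integral>x. (g n x - f x)\<^sup>2 \<partial>M) \<longlonglongrightarrow> 0"
  shows "(\<lambda>n. \<integral>x. (g n x)\<^sup>2 \<partial>M) \<longlonglongrightarrow> (\<integral>x. (f x)\<^sup>2 \<partial>M)"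
proof -
  have ab: "2 * \<bar>a * b\<bar> \<le> e * a\<^sup>2 + b\<^sup>2 / e" if "e > 0" for a b e :: real
  proof -
    have "0 \<le> (e * \<bar>a\<bar> - \<bar>b\<bar>)\<^sup>2 / e" using that by simp
    also have "(e * \<bar>a\<bar> - \<bar>b\<bar>)\<^sup>2 / e = e * a\<^sup>2 + b\<^sup>2 / e - 2 * \<bar>a * b\<bar>"
      using that by (simp add: power2_diff power_mult_distrib abs_mult field_simps power2_eq_square)
    finally show ?thesis by simp
  qed
  have int_fg: "integrable M (\<lambda>x. f x * (g n x - f x))" for n
    using f d by (intro integrable_mult_square) auto
  have int_g: "integrable M (\<lambda>x. (g n x)\<^sup>2)" for n
  proof -
    have "integrable M (\<lambda>x. (f x)\<^sup>2 + 2 * (f x * (g n x - f x)) + (g n x - f x)\<^sup>2)"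
      using f d int_fg by simp
    also have "(\<lambda>x. (f x)\<^sup>2 + 2 * (f x * (g n x - f x)) + (g n x - f x)\<^sup>2) = (\<lambda>x. (g n x)\<^sup>2)"
      by (simp add: power2_eq_square algebra_simps)
    finally show ?thesis .
  qed
  define s where "s n = sqrt (\<integral>x. (g n x - f x)\<^sup>2 \<partial>M)" for n
  \<comment> \<open>The norm \<open>s n\<close> as weight makes both halves of the split vanish: (s
    n)^2 / e n <= s n, while e n tends to 0. The summand 1 / (n+1) keeps the weight positive when
    \<open>s n\<close> is 0.\<close>
  define e where "e n = s n + 1 / real (Suc n)" for n
  have s0: "s n \<ge> 0" and s2: "(\<integral>x. (g n x - f x)\<^sup>2 \<partial>M) = s n * s n" for n
    by (simp_all add: s_def)
  have s: "s \<longlonglongrightarrow> 0" unfolding s_def using tendsto_real_sqrt[OF lim] by simp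
  have e: "e \<longlonglongrightarrow> 0" unfolding e_def using tendsto_add[OF s LIMSEQ_Suc[OF lim_1_over_n]] by simp
  have e0: "e n > 0" for n unfolding e_def using s0[of n] by (simp add: add_nonneg_pos)
  have "\<bar>(\<integral>x. (g n x)\<^sup>2 \<partial>M) - (\<integral>x. (f x)\<^sup>2 \<partial>M)\<bar> \<le> e n * (\<integral>x. (f x)\<^sup>2 \<partial>M) + s n + s n * s n" for n
  proof -
    have "\<bar>(\<integral>x. (g n x)\<^sup>2 \<partial>M) - (\<integral>x. (f x)\<^sup>2 \<partial>M)\<bar> = \<bar>\<integral>x. (g n x)\<^sup>2 - (f x)\<^sup>2 \<partial>M\<bar>"
      using int_g f by simp
    also have "\<dots> \<le> (\<integral>x. \<bar>(g n x)\<^sup>2 - (f x)\<^sup>2\<bar> \<partial>M)" by (rule integral_abs_bound)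
    also have "\<dots> \<le> (\<integral>x. e n * (f x)\<^sup>2 + (1 / e n + 1) * (g n x - f x)\<^sup>2 \<partial>M)"
    proof (rule integral_mono)
      fix x
      have "(g n x)\<^sup>2 - (f x)\<^sup>2 = 2 * (f x * (g n x - f x)) + (g n x - f x)\<^sup>2"
        by (simp add: power2_eq_square algebra_simps)
      then have "\<bar>(g n x)\<^sup>2 - (f x)\<^sup>2\<bar> \<le> 2 * \<bar>f x * (g n x - f x)\<bar> + (g n x - f x)\<^sup>2"
        using abs_triangle_ineq[of "2 * (f x * (g n x - f x))" "(g n x - f x)\<^sup>2"] by (simp add: abs_mult)
      also have "\<dots> \<le> e n * (f x)\<^sup>2 + (1 / e n + 1) * (g n x - f x)\<^sup>2"
        using ab[OF e0[of n], of "f x" "g n x - f x"] by (simp add: algebra_simps)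
      finally show "\<bar>(g n x)\<^sup>2 - (f x)\<^sup>2\<bar> \<le> e n * (f x)\<^sup>2 + (1 / e n + 1) * (g n x - f x)\<^sup>2" .
    qed (use int_g f d in auto)
    also have "\<dots> = e n * (\<integral>x. (f x)\<^sup>2 \<partial>M) + (s n / e n) * s n + s n * s n"
      using f d by (simp add: s2 algebra_simps)
    also have "(s n / e n) * s n \<le> 1 * s n"
      using s0[of n] e0[of n] by (intro mult_right_mono) (auto simp: e_def)
    finally show ?thesis by simp
  qed
  moreover have lim0: "(\<lambda>n. e n * (\<integral>x. (f x)\<^sup>2 \<partial>M) + s n + s n * s n) \<longlonglongrightarrow> 0"
    using tendsto_add[OF tendsto_add[OF tendsto_mult_left_zero[OF e] s] tendsto_mult_zero[OF s s]]
    by simp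
  ultimately show ?thesis
    by (intro LIM_zero_cancel[where f="\<lambda>n. \<integral>x. (g n x)\<^sup>2 \<partial>M"] Lim_null_comparison[OF _ lim0]
        always_eventually allI) simp
qed

section \<open>Characteristic functions of L2-close variables; unboundedness of Gaussian
  variables\<close>

context prob_space begin

lemma expectation_square_le:
  fixes X :: "'a \<Rightarrow> real"
  assumes [measurable]: "X \<in> borel_measurable M" and "integrable M (\<lambda>x. (X x)\<^sup>2)"
  shows "(expectation X)\<^sup>2 \<le> expectation (\<lambda>x. (X x)\<^sup>2)"
  using variance_positive[of X] variance_eq[OF square_integrable_imp_integrable[OF assms] assms(2)]
  by simp

text \<open>The map a |-> exp(ia) is 1-Lipschitz, and E|Z| <= sqrt(E Z^2). Characteristic functions
  thus pass to L2 limits directly, without a detour through weak convergence.\<close>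

lemma char_diff_le:
  fixes X Y :: "'a \<Rightarrow> real"
  assumes [measurable]: "X \<in> borel_measurable M" "Y \<in> borel_measurable M"
    and int: "integrable M (\<lambda>x. (X x - Y x)\<^sup>2)"
  shows "norm (char (distr M borel X) u - char (distr M borel Y) u)
    \<le> \<bar>u\<bar> * sqrt (expectation (\<lambda>x. (X x - Y x)\<^sup>2))"
proof -
  have iexp_diff: "norm (iexp a - iexp b) \<le> \<bar>a - b\<bar>" for a b :: real
  proof -
    have "iexp a - iexp b = iexp b * (iexp (a - b) - 1)"
      by (simp add: algebra_simps flip: exp_add)
    then have "norm (iexp a - iexp b) = 2 * \<bar>sin ((a - b) / 2)\<bar>"
      using dist_exp_i_1[of "a - b"] by (simp add: norm_mult)
    also have "\<dots> \<le> \<bar>a - b\<bar>" using abs_sin_x_le_abs_x[of "(a - b) / 2"] by simp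
    finally show ?thesis .
  qed
  have int1: "integrable M (\<lambda>x. \<bar>X x - Y x\<bar>)"
    using square_integrable_imp_integrable[OF _ int] by simp
  have ie: "integrable M (\<lambda>x. iexp (u * Z x))" if "Z \<in> borel_measurable M" for Z
    using that by (intro integrable_iexp) auto
  have "norm (char (distr M borel X) u - char (distr M borel Y) u) = norm (CLINT x|M. iexp (u * X x) - iexp (u * Y x))"
    using ie[of X] ie[of Y] by (simp add: char_def integral_distr)
  also have "\<dots> \<le> (\<integral>x. norm (iexp (u * X x) - iexp (u * Y x)) \<partial>M)"
    by (rule integral_norm_bound)
  also have "\<dots> \<le> (\<integral>x. \<bar>u\<bar> * \<bar>X x - Y x\<bar> \<partial>M)"
  proof (rule integral_mono)
    show "integrable M (\<lambda>x. cmod (iexp (u * X x) - iexp (u * Y x)))"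
      using ie[of X] ie[of Y] by (intro integrable_norm Bochner_Integration.integrable_diff) auto
    show "integrable M (\<lambda>x. \<bar>u\<bar> * \<bar>X x - Y x\<bar>)" using int1 by simp
    show "cmod (iexp (u * X x) - iexp (u * Y x)) \<le> \<bar>u\<bar> * \<bar>X x - Y x\<bar>" for x
      using iexp_diff[of "u * X x" "u * Y x"] by (simp flip: abs_mult right_diff_distrib)
  qed
  also have "\<dots> = \<bar>u\<bar> * expectation (\<lambda>x. \<bar>X x - Y x\<bar>)" by simp
  also have "expectation (\<lambda>x. \<bar>X x - Y x\<bar>) \<le> sqrt (expectation (\<lambda>x. (X x - Y x)\<^sup>2))"
    using expectation_square_le[of "\<lambda>x. \<bar>X x - Y x\<bar>"] int by (intro real_le_rsqrt) auto
  finally show ?thesis by (simp add: mult_left_mono)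
qed

text \<open>After normalisation, uniqueness of characteristic functions makes the law standard
  normal. Its density is positive everywhere, so an almost sure bound would hold Lebesgue-almost
  everywhere on the line.\<close>

lemma gaussian_not_bounded:
  fixes X :: "'a \<Rightarrow> real"
  assumes [measurable]: "X \<in> borel_measurable M" and "v > 0"
    and char: "\<And>u. char (distr M borel X) u = exp (- u\<^sup>2 * v / 2)"
  shows "\<not> (AE x in M. \<bar>X x\<bar> \<le> B)"
proof
  assume bd: "AE x in M. \<bar>X x\<bar> \<le> B"
  define Z where "Z x = X x / sqrt v" for x
  have [measurable]: "Z \<in> borel_measurable M" unfolding Z_def by simp
  have "char (distr M borel Z) u = char std_normal_distribution u" for u
  proof -
    have "char (distr M borel Z) u = char (distr M borel X) (u / sqrt v)"
      by (simp add: char_def integral_distr Z_def)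
    also have "\<dots> = exp (- (u / sqrt v)\<^sup>2 * v / 2)" by (rule char)
    also have "\<dots> = exp (- u\<^sup>2 / 2)" using \<open>v > 0\<close> by (simp add: power_divide)
    finally show ?thesis by (simp add: char_std_normal_distribution)
  qed
  then have Z: "distr M borel Z = std_normal_distribution"
    by (intro Levy_uniqueness real_dist_normal_dist ext real_distribution_distr) auto
  define b where "b = B / sqrt v"
  have "AE x in M. \<bar>Z x\<bar> \<le> b"
    using bd \<open>v > 0\<close> by (auto simp: Z_def b_def abs_divide divide_right_mono)
  then have "AE z in distr M borel Z. \<bar>z\<bar> \<le> b"
    by (subst AE_distr_iff) auto
  then have "AE z in density lborel std_normal_density. \<bar>z\<bar> \<le> b"
    unfolding Z .
  then have "AE z in lborel. \<bar>z\<bar> \<le> b"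
    by (subst (asm) AE_density) (auto simp: normal_density_pos)
  then have "emeasure lborel {z. \<not> \<bar>z\<bar> \<le> b} = 0"
    by (subst (asm) AE_iff_measurable[OF _ refl]) auto
  \<comment> \<open>The absolute value covers a negative \<open>b\<close>; the interval has length 1
    and avoids all points with \<bar>z\<bar> \<le> b.\<close>
  moreover have "emeasure lborel {\<bar>b\<bar><..<\<bar>b\<bar> + 1} \<le> emeasure lborel {z. \<not> \<bar>z\<bar> \<le> b}"
    by (intro emeasure_mono) auto
  ultimately show False by simp
qed

end

text \<open>By strict monotonicity the weight is 1 exactly for j < k, and the sum telescopes.
  Keeping the full range j < N allows the sums for different end points to be added term by
  term.\<close>

lemma sum_increments:
  fixes t :: "nat \<Rightarrow> real" and g :: "real \<Rightarrow> real"
  assumes "strict_mono_on {..N} t" "k \<le> N"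
  shows "(\<Sum>j<N. of_bool (t (Suc j) \<le> t k) * (g (t (Suc j)) - g (t j))) = g (t k) - g (t 0)"
proof -
  have "(\<Sum>j<N. of_bool (t (Suc j) \<le> t k) * (g (t (Suc j)) - g (t j))) = (\<Sum>j<k. g (t (Suc j)) - g (t j))"
    using assms by (intro sum.mono_neutral_cong_right) (auto simp: strict_mono_on_less_eq)
  then show ?thesis by (simp only: sum_lessThan_telescope[of "\<lambda>j. g (t j)" k])
qed

section \<open>Gaussian law of elementary integrals and of their L2 limits\<close>

context wiener_measure begin

text \<open>Point evaluations are dependent, increments are not: along the sorted points the
  elementary integral becomes a weighted sum of independent Gaussian increments, and its
  characteristic function factorises.\<close>

lemma char_elem_int:
  assumes P: "finite P" "P \<subseteq> {0..1}"
  shows "char (distr \<mu> borel (elem_int P c)) u = exp (- u\<^sup>2 * expectation (\<lambda>w. (elem_int P c w)\<^sup>2) / 2)"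
proof -
  \<comment> \<open>Inserting 0 makes the list nonempty and lets it start at \<open>t 0 = 0\<close>,
    where paths vanish, so every w p is a sum of increments. A list of N + 1 points has N
    increments.\<close>
  define xs where "xs = sorted_list_of_set (insert 0 P)"
  define N where "N = length xs - 1"
  define t where "t j = xs ! j" for j
  have xs: "set xs = insert 0 P" "sorted_wrt (<) xs" "xs \<noteq> []"
    using P by (auto simp: xs_def simp del: sorted_list_of_set_insert_remove)
  then have mono: "strict_mono_on {..N} t"
    by (auto simp: strict_mono_on_def t_def N_def sorted_wrt_iff_nth_less)
  have P_eq: "t ` {..N} = insert 0 P"
  proof -
    have "{..N} = {..<length xs}" using xs(3) by (cases xs) (auto simp: N_def less_Suc_eq_le)
    then show ?thesis using xs(1) by (auto simp: t_def set_conv_nth)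
  qed
  have t01: "t j \<in> {0..1}" if "j \<le> N" for j
  proof -
    have "t j \<in> insert 0 P" unfolding P_eq[symmetric] using that by simp
    then show ?thesis using P by auto
  qed
  have t0: "t 0 = 0"
  proof -
    obtain i where "i \<le> N" "t i = 0" by (metis P_eq atMost_iff image_iff insertI1)
    then have "t 0 \<le> 0" using mono strict_mono_on_leD[OF mono, of 0 i] by auto
    then show ?thesis using t01[of 0] by simp
  qed
  define D where "D j w = w (t (Suc j)) - w (t j)" for j and w :: "real \<Rightarrow> real"
  \<comment> \<open>Abel summation: the increment ending at t (j+1) enters w p for each p that is
    not to the left of t (j+1), so the coefficients of these p add up.\<close>
  define e where "e j = (\<Sum>p\<in>P. c p * of_bool (t (Suc j) \<le> p))" for j
  have incr: "(\<Sum>j<N. of_bool (t (Suc j) \<le> p) * (g (t (Suc j)) - g (t j))) = g p - g 0"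
    if "p \<in> insert 0 P" for p and g :: "real \<Rightarrow> real"
  proof -
    from that P_eq obtain k where "k \<le> N" "p = t k" by (metis atMost_iff image_iff)
    with sum_increments[OF mono, of k g] show ?thesis by (simp add: t0)
  qed
  have eq: "elem_int P c w = (\<Sum>j<N. e j * D j w)" if "w \<in> space \<mu>" for w
  proof -
    have "elem_int P c w = (\<Sum>p\<in>P. c p * (\<Sum>j<N. of_bool (t (Suc j) \<le> p) * D j w))"
      unfolding elem_int_def D_def by (intro sum.cong refl, subst incr) (auto simp: at_0[OF that])
    also have "\<dots> = (\<Sum>j<N. e j * D j w)"
      unfolding e_def sum_distrib_left sum_distrib_right by (subst sum.swap) (simp add: mult.assoc)
    finally show ?thesis .
  qed
  have "expectation (\<lambda>w. (elem_int P c w)\<^sup>2) = (\<Sum>p\<in>P. \<Sum>q\<in>P. c p * c q * min p q)"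
    using elem_int_square_integral[OF P] by (simp add: has_bochner_integral_iff)
  \<comment> \<open>\<open>incr\<close> for the identity in place of a path: \<open>min p q\<close>
    is the total length of the intervals lying below both p and q. This turns the double sum over
    points into squares of \<open>e j\<close>.\<close>
  also have "\<dots> = (\<Sum>p\<in>P. \<Sum>q\<in>P. c p * c q * (\<Sum>j<N. of_bool (t (Suc j) \<le> min p q) * (t (Suc j) - t j)))"
    by (intro sum.cong refl, subst incr[of _ "\<lambda>x. x"]) (auto simp: min_def)
  also have "\<dots> = (\<Sum>j<N. (e j)\<^sup>2 * (t (Suc j) - t j))"
  proof -
    have "(\<Sum>j<N. (e j)\<^sup>2 * (t (Suc j) - t j)) =
      (\<Sum>j<N. \<Sum>p\<in>P. \<Sum>q\<in>P. c p * c q * (of_bool (t (Suc j) \<le> min p q) * (t (Suc j) - t j)))"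
      unfolding e_def power2_eq_square sum_product
      unfolding sum_distrib_right by (intro sum.cong refl) auto
    then show ?thesis
      unfolding sum_distrib_left by (simp add: sum.swap[of _ "{..<N}"])
  qed
  finally have var: "expectation (\<lambda>w. (elem_int P c w)\<^sup>2) = (\<Sum>j<N. (e j)\<^sup>2 * (t (Suc j) - t j))" .
  have less: "t j < t (Suc j)" if "j < N" for j
    using that strict_mono_onD[OF mono, of j "Suc j"] by simp
  have "indep_vars (\<lambda>_. borel) D {..<N}"
    unfolding D_def using t01[of 0] t01[of N] less by (intro indep_increments) auto
  then have ind: "indep_vars (\<lambda>_. borel) (\<lambda>j w. e j * D j w) {..<N}"
    by (rule indep_vars_compose2) simp
  have "distr \<mu> borel (elem_int P c) = distr \<mu> borel (\<lambda>w. \<Sum>j<N. e j * D j w)"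
    by (rule distr_cong) (auto simp: eq)
  then have "char (distr \<mu> borel (elem_int P c)) u = (\<Prod>j<N. char (distr \<mu> borel (\<lambda>w. e j * D j w)) u)"
    using char_distr_sum[OF ind] by simp
  also have "\<dots> = (\<Prod>j<N. complex_of_real (exp (- u\<^sup>2 * ((e j)\<^sup>2 * (t (Suc j) - t j)) / 2)))"
    unfolding D_def
  proof (intro prod.cong refl char_increment)
    fix j assume "j \<in> {..<N}"
    then show "0 \<le> t j" "t j < t (Suc j)" "t (Suc j) \<le> 1" using t01[of j] t01[of "Suc j"] less by auto
  qed
  also have "\<dots> = exp (\<Sum>j<N. - u\<^sup>2 * ((e j)\<^sup>2 * (t (Suc j) - t j)) / 2)"
    by (simp add: exp_sum)
  also have "(\<Sum>j<N. - u\<^sup>2 * ((e j)\<^sup>2 * (t (Suc j) - t j)) / 2) = - u\<^sup>2 * expectation (\<lambda>w. (elem_int P c w)\<^sup>2) / 2"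
    unfolding var by (simp add: sum_distrib_left sum_divide_distrib sum_negf)
  finally show ?thesis .
qed

text \<open>Along the approximation the variances converge by \<open>L2_norm_tendsto\<close> and the
  characteristic functions by \<open>char_diff_le\<close>; both sides of the formula for elementary
  integrals pass to the limit.\<close>

lemma char_L2_limit:
  assumes [measurable]: "X \<in> borel_measurable \<mu>"
    and X: "integrable \<mu> (\<lambda>w. (X w)\<^sup>2)"
    and P: "\<And>n. finite (P n)" "\<And>n. P n \<subseteq> {0..1}"
    and int: "\<And>n. integrable \<mu> (\<lambda>w. (elem_int (P n) (c n) w - X w)\<^sup>2)"
    and lim: "(\<lambda>n::nat. expectation (\<lambda>w. (elem_int (P n) (c n) w - X w)\<^sup>2)) \<longlonglongrightarrow> 0"
  shows "char (distr \<mu> borel X) u = exp (- u\<^sup>2 * expectation (\<lambda>w. (X w)\<^sup>2) / 2)"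
proof -
  have [measurable]: "elem_int (P n) (c n) \<in> borel_measurable \<mu>" for n
    using P by simp
  let ?Y = "\<lambda>n. elem_int (P n) (c n)"
  have "(\<lambda>n. expectation (\<lambda>w. (?Y n w)\<^sup>2)) \<longlonglongrightarrow> expectation (\<lambda>w. (X w)\<^sup>2)"
    by (rule L2_norm_tendsto) (use X int lim in auto)
  then have "(\<lambda>n. complex_of_real (exp (- u\<^sup>2 * expectation (\<lambda>w. (?Y n w)\<^sup>2) / 2)))
    \<longlonglongrightarrow> exp (- u\<^sup>2 * expectation (\<lambda>w. (X w)\<^sup>2) / 2)"
    by (intro tendsto_intros) auto
  moreover have "(\<lambda>n. char (distr \<mu> borel (?Y n)) u) \<longlonglongrightarrow> char (distr \<mu> borel X) u"
  proof (rule LIM_zero_cancel, rule Lim_null_comparison)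
    show "\<forall>\<^sub>F n in sequentially. norm (char (distr \<mu> borel (?Y n)) u - char (distr \<mu> borel X) u)
      \<le> \<bar>u\<bar> * sqrt (expectation (\<lambda>w. (?Y n w - X w)\<^sup>2))"
      using int by (intro always_eventually allI char_diff_le) auto
    show "(\<lambda>n. \<bar>u\<bar> * sqrt (expectation (\<lambda>w. (?Y n w - X w)\<^sup>2))) \<longlonglongrightarrow> 0"
      using tendsto_mult_right_zero[OF tendsto_real_sqrt[OF lim, unfolded real_sqrt_zero]] .
  qed
  ultimately show ?thesis
    using P by (simp add: char_elem_int LIMSEQ_unique)
qed

end

section \<open>Density of step kernels\<close>

abbreviation leb_square :: "(real \<times> real) measure"
  where "leb_square \<equiv> leb01 \<Otimes>\<^sub>M leb01"

text \<open>Only s is integrated against the path, so steps are required in s alone. One bound for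
  all coefficients makes the resulting elementary integral a bounded function of \<eta> at every
  path, not merely at almost every one.\<close>

definition elem_kernels :: "(real \<times> real \<Rightarrow> real) set"
  where "elem_kernels = {h. \<exists>P g C. finite P \<and> P \<subseteq> {0..1} \<and>
    (\<forall>p. g p \<in> borel_measurable leb01 \<and> (\<forall>\<eta>. \<bar>g p \<eta>\<bar> \<le> C)) \<and>
    h = (\<lambda>(s, \<eta>). elem_fun P (\<lambda>p. g p \<eta>) s)}"

definition L2_closure :: "(real \<times> real \<Rightarrow> real) set"
  where "L2_closure = {f \<in> borel_measurable leb_square. \<forall>\<epsilon>>0. \<exists>h\<in>elem_kernels.
    (\<integral>\<^sup>+x. ennreal ((f x - h x)\<^sup>2) \<partial>leb_square) < ennreal \<epsilon>}"

lemma elem_kernelsE: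
  assumes "h \<in> elem_kernels"
  obtains P g C where "finite P" "P \<subseteq> {0..1}" "\<And>p. g p \<in> borel_measurable leb01"
    "\<And>p \<eta>. \<bar>g p \<eta>\<bar> \<le> C" "h = (\<lambda>(s, \<eta>). elem_fun P (\<lambda>p. g p \<eta>) s)"
proof -
  from assms obtain P g C where "finite P \<and> P \<subseteq> {0..1} \<and>
    (\<forall>p. g p \<in> borel_measurable leb01 \<and> (\<forall>\<eta>. \<bar>g p \<eta>\<bar> \<le> C)) \<and>
    h = (\<lambda>(s, \<eta>). elem_fun P (\<lambda>p. g p \<eta>) s)"
    unfolding elem_kernels_def mem_Collect_eq by (elim exE) (rule that)
  then show ?thesis
    using that[of P g C] by simp
qed

lemma elem_kernels_measurable:
  assumes "h \<in> elem_kernels"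
  shows "h \<in> borel_measurable leb_square"
proof -
  obtain P g where [measurable]: "\<And>p. g p \<in> borel_measurable leb01"
    and h: "h = (\<lambda>(s, \<eta>). elem_fun P (\<lambda>p. g p \<eta>) s)"
    using assms by (rule elem_kernelsE) (rule that)
  have [measurable]: "fst \<in> borel_measurable leb_square"
    using measurable_compose[OF measurable_fst measurable_ident_leb01] by simp
  show ?thesis unfolding h elem_fun_def split_beta by measurable
qed

lemma ennreal_quarters:
  assumes "\<epsilon> > 0"
  shows "2 * ennreal (\<epsilon> / 4) + 2 * ennreal (\<epsilon> / 4) = ennreal \<epsilon>"
proof -
  have "2 * ennreal (\<epsilon> / 4) = ennreal (\<epsilon> / 2)"
    using assms ennreal_mult[of 2 "\<epsilon> / 4"] by simp
  then show ?thesis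
    using assms ennreal_plus[of "\<epsilon> / 2" "\<epsilon> / 2"] by simp
qed

lemma elem_kernels_add:
  assumes "h \<in> elem_kernels" "k \<in> elem_kernels"
  shows "(\<lambda>x. h x + k x) \<in> elem_kernels"
proof -
  obtain P g C where P: "finite P" "P \<subseteq> {0..1}" "\<And>p. g p \<in> borel_measurable leb01"
    "\<And>p \<eta>. \<bar>g p \<eta>\<bar> \<le> C" "h = (\<lambda>(s, \<eta>). elem_fun P (\<lambda>p. g p \<eta>) s)"
    using assms(1) by (rule elem_kernelsE) (rule that)
  obtain Q g' C' where Q: "finite Q" "Q \<subseteq> {0..1}" "\<And>p. g' p \<in> borel_measurable leb01"
    "\<And>p \<eta>. \<bar>g' p \<eta>\<bar> \<le> C'" "k = (\<lambda>(s, \<eta>). elem_fun Q (\<lambda>p. g' p \<eta>) s)"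
    using assms(2) by (rule elem_kernelsE) (rule that)
  let ?e = "\<lambda>p \<eta>. (if p \<in> P then g p \<eta> else 0) + (if p \<in> Q then g' p \<eta> else 0)"
  have "0 \<le> C" "0 \<le> C'" using P(4)[of 0 0] Q(4)[of 0 0] by linarith+
  then have "\<bar>?e p \<eta>\<bar> \<le> C + C'" for p \<eta>
    using P(4)[of p \<eta>] Q(4)[of p \<eta>] by auto
  moreover have "?e p \<in> borel_measurable leb01" for p
    using P(3)[of p] Q(3)[of p] by (cases "p \<in> P"; cases "p \<in> Q") auto
  ultimately show ?thesis
    unfolding elem_kernels_def mem_Collect_eq
    by (intro exI[of _ "P \<union> Q"] exI[of _ ?e] exI[of _ "C + C'"])
       (use P Q in \<open>auto simp: elem_add(1)\<close>)
qed

lemma elem_kernels_scale: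
  assumes "h \<in> elem_kernels"
  shows "(\<lambda>x. c * h x) \<in> elem_kernels"
proof -
  obtain P g C where P: "finite P" "P \<subseteq> {0..1}" "\<And>p. g p \<in> borel_measurable leb01"
    "\<And>p \<eta>. \<bar>g p \<eta>\<bar> \<le> C" "h = (\<lambda>(s, \<eta>). elem_fun P (\<lambda>p. g p \<eta>) s)"
    using assms(1) by (rule elem_kernelsE) (rule that)
  then show ?thesis
    unfolding elem_kernels_def mem_Collect_eq
    by (intro exI[of _ P] exI[of _ "\<lambda>p \<eta>. c * g p \<eta>"] exI[of _ "\<bar>c\<bar> * C"])
       (auto simp: elem_fun_def sum_distrib_left abs_mult mult_left_mono mult.assoc
         simp del: sum_mult_indicator)
qed

text \<open>The closure is closed: approximate first inside it, then by an elementary kernel. The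
  factors 2 of the squared triangle inequality account for the quarters of \<epsilon>.\<close>

lemma L2_closureI:
  assumes [measurable]: "f \<in> borel_measurable leb_square"
    and approx: "\<And>\<epsilon>. \<epsilon> > 0 \<Longrightarrow> \<exists>g\<in>L2_closure. (\<integral>\<^sup>+x. ennreal ((f x - g x)\<^sup>2) \<partial>leb_square) < ennreal \<epsilon>"
  shows "f \<in> L2_closure"
  unfolding L2_closure_def
proof (intro CollectI conjI allI impI)
  fix \<epsilon> :: real assume "\<epsilon> > 0"
  then obtain g where g: "g \<in> L2_closure" "(\<integral>\<^sup>+x. ennreal ((f x - g x)\<^sup>2) \<partial>leb_square) < ennreal (\<epsilon> / 4)"
    using approx[of "\<epsilon> / 4"] by auto
  then obtain h where h: "h \<in> elem_kernels" "(\<integral>\<^sup>+x. ennreal ((g x - h x)\<^sup>2) \<partial>leb_square) < ennreal (\<epsilon> / 4)"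
    using \<open>\<epsilon> > 0\<close> unfolding L2_closure_def by (auto dest!: spec[of _ "\<epsilon> / 4"])
  have "(\<integral>\<^sup>+x. ennreal ((f x - h x)\<^sup>2) \<partial>leb_square) \<le> 2 * (\<integral>\<^sup>+x. ennreal ((f x - g x)\<^sup>2) \<partial>leb_square)
    + 2 * (\<integral>\<^sup>+x. ennreal ((g x - h x)\<^sup>2) \<partial>leb_square)"
    using g(1) elem_kernels_measurable[OF h(1)]
    by (intro nn_integral_diff_square_le) (auto simp: L2_closure_def)
  also have "\<dots> < 2 * ennreal (\<epsilon> / 4) + 2 * ennreal (\<epsilon> / 4)"
    using g(2) h(2) by (intro add_strict_mono ennreal_mult_strict_left_mono) auto
  finally show "\<exists>h\<in>elem_kernels. (\<integral>\<^sup>+x. ennreal ((f x - h x)\<^sup>2) \<partial>leb_square) < ennreal \<epsilon>"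
    using h(1) by (auto simp: ennreal_quarters[OF \<open>\<epsilon> > 0\<close>])
qed simp

lemma L2_closure_elem: "h \<in> elem_kernels \<Longrightarrow> h \<in> L2_closure"
  unfolding L2_closure_def by (auto intro!: bexI[of _ h] elem_kernels_measurable)

lemma L2_closure_cong:
  assumes f: "f \<in> L2_closure" and eq: "\<And>x. x \<in> space leb_square \<Longrightarrow> f x = g x"
  shows "g \<in> L2_closure"
proof (rule L2_closureI)
  show "g \<in> borel_measurable leb_square"
    using f eq measurable_cong[of leb_square f g] unfolding L2_closure_def by auto
  have "(\<integral>\<^sup>+x. ennreal ((g x - f x)\<^sup>2) \<partial>leb_square) = 0"
    by (subst nn_integral_cong[where v="\<lambda>_. 0"]) (auto simp: eq)
  then show "\<exists>f\<in>L2_closure. (\<integral>\<^sup>+x. ennreal ((g x - f x)\<^sup>2) \<partial>leb_square) < ennreal \<epsilon>" if "\<epsilon> > 0" for \<epsilon>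
    using f that by (intro bexI[of _ f]) auto
qed

lemma L2_closure_add:
  assumes "f \<in> L2_closure" "g \<in> L2_closure"
  shows "(\<lambda>x. f x + g x) \<in> L2_closure"
proof (rule L2_closureI)
  have [measurable]: "f \<in> borel_measurable leb_square" "g \<in> borel_measurable leb_square"
    using assms by (auto simp: L2_closure_def)
  show "(\<lambda>x. f x + g x) \<in> borel_measurable leb_square" by simp
  fix \<epsilon> :: real assume "\<epsilon> > 0"
  then obtain h k where h: "h \<in> elem_kernels" "(\<integral>\<^sup>+x. ennreal ((f x - h x)\<^sup>2) \<partial>leb_square) < ennreal (\<epsilon> / 4)"
    and k: "k \<in> elem_kernels" "(\<integral>\<^sup>+x. ennreal ((g x - k x)\<^sup>2) \<partial>leb_square) < ennreal (\<epsilon> / 4)"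
    using assms unfolding L2_closure_def by (auto dest!: spec[of _ "\<epsilon> / 4"])
  have [measurable]: "h \<in> borel_measurable leb_square" "k \<in> borel_measurable leb_square"
    using elem_kernels_measurable h(1) k(1) by auto
  have "(\<integral>\<^sup>+x. ennreal ((f x + g x - (h x + k x))\<^sup>2) \<partial>leb_square)
    \<le> 2 * (\<integral>\<^sup>+x. ennreal ((f x + g x - (h x + g x))\<^sup>2) \<partial>leb_square)
    + 2 * (\<integral>\<^sup>+x. ennreal ((h x + g x - (h x + k x))\<^sup>2) \<partial>leb_square)"
    by (rule nn_integral_diff_square_le) auto
  also have "\<dots> < 2 * ennreal (\<epsilon> / 4) + 2 * ennreal (\<epsilon> / 4)"
    using h(2) k(2) by (intro add_strict_mono ennreal_mult_strict_left_mono) auto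
  finally show "\<exists>e\<in>L2_closure. (\<integral>\<^sup>+x. ennreal ((f x + g x - e x)\<^sup>2) \<partial>leb_square) < ennreal \<epsilon>"
    using L2_closure_elem[OF elem_kernels_add[OF h(1) k(1)]]
    by (auto simp: ennreal_quarters[OF \<open>\<epsilon> > 0\<close>])
qed

lemma L2_closure_scale:
  assumes "f \<in> L2_closure"
  shows "(\<lambda>x. c * f x) \<in> L2_closure"
proof (rule L2_closureI)
  have [measurable]: "f \<in> borel_measurable leb_square"
    using assms by (auto simp: L2_closure_def)
  show "(\<lambda>x. c * f x) \<in> borel_measurable leb_square" by simp
  fix \<epsilon> :: real assume "\<epsilon> > 0"
  define d where "d = \<epsilon> / (c\<^sup>2 + 1)"
  have "0 < c\<^sup>2 + 1" by (simp add: add_nonneg_pos)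
  then have "d > 0" and cd: "c\<^sup>2 * d < \<epsilon>" using \<open>\<epsilon> > 0\<close> by (auto simp: d_def field_simps)
  then obtain h where h: "h \<in> elem_kernels" "(\<integral>\<^sup>+x. ennreal ((f x - h x)\<^sup>2) \<partial>leb_square) < ennreal d"
    using assms unfolding L2_closure_def by auto
  have [measurable]: "h \<in> borel_measurable leb_square"
    using elem_kernels_measurable h(1) by auto
  have "(\<integral>\<^sup>+x. ennreal ((c * f x - c * h x)\<^sup>2) \<partial>leb_square)
    = ennreal (c\<^sup>2) * (\<integral>\<^sup>+x. ennreal ((f x - h x)\<^sup>2) \<partial>leb_square)"
    by (subst nn_integral_cmult[symmetric])
       (auto simp: power_mult_distrib simp flip: ennreal_mult right_diff_distrib)
  also have "\<dots> \<le> ennreal (c\<^sup>2) * ennreal d"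
    using h(2) by (intro mult_left_mono) auto
  also have "\<dots> < ennreal \<epsilon>"
    using cd \<open>d > 0\<close> \<open>\<epsilon> > 0\<close> by (simp add: ennreal_less_iff flip: ennreal_mult)
  finally show "\<exists>e\<in>L2_closure. (\<integral>\<^sup>+x. ennreal ((c * f x - e x)\<^sup>2) \<partial>leb_square) < ennreal \<epsilon>"
    using L2_closure_elem[OF elem_kernels_scale[OF h(1)]] by auto
qed

lemma L2_closure_zero: "(\<lambda>_. 0) \<in> L2_closure"
  by (rule L2_closure_elem)
     (auto simp: elem_kernels_def elem_fun_def intro!: exI[of _ "{}"] exI[of _ "\<lambda>_ _. 0"] exI[of _ 0])

lemma L2_closure_diff:
  assumes "f \<in> L2_closure" "g \<in> L2_closure"
  shows "(\<lambda>x. f x - g x) \<in> L2_closure"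
  using L2_closure_add[OF assms(1) L2_closure_scale[OF assms(2), of "-1"]] by simp

lemma L2_closure_sum:
  assumes "\<And>i. i \<in> I \<Longrightarrow> f i \<in> L2_closure"
  shows "(\<lambda>x. \<Sum>i\<in>I. f i x) \<in> L2_closure"
  using assms
  by (induction I rule: infinite_finite_induct) (auto intro: L2_closure_add L2_closure_zero)

text \<open>Domination is asked of the squared errors, which fits both uses: the constant 1 for
  indicators of disjoint unions and 9 f^2 for simple functions approximating f.\<close>

lemma L2_closure_dominated:
  assumes f: "\<And>n. f n \<in> L2_closure" and [measurable]: "g \<in> borel_measurable leb_square"
    and w: "integrable leb_square w"
    and bd: "\<And>n x. x \<in> space leb_square \<Longrightarrow> (f n x - g x)\<^sup>2 \<le> w x"
    and lim: "\<And>x. x \<in> space leb_square \<Longrightarrow> (\<lambda>n::nat. f n x) \<longlonglongrightarrow> g x"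
  shows "g \<in> L2_closure"
proof (rule L2_closureI)
  have [measurable]: "f n \<in> borel_measurable leb_square" for n
    using f by (auto simp: L2_closure_def)
  fix \<epsilon> :: real assume "\<epsilon> > 0"
  have w0: "0 \<le> w x" if "x \<in> space leb_square" for x
    using bd[OF that, of 0] zero_le_power2 by (rule order_trans[rotated])
  have "(\<lambda>n. \<integral>\<^sup>+x. ennreal ((g x - f n x)\<^sup>2) \<partial>leb_square) \<longlonglongrightarrow> (\<integral>\<^sup>+x. 0 \<partial>leb_square)"
  proof (rule nn_integral_dominated_convergence[where w="\<lambda>x. ennreal (w x)"])
    show "(\<integral>\<^sup>+x. ennreal (w x) \<partial>leb_square) < \<infinity>"
      using integrableD(2)[OF w] w0 by (simp add: nn_integral_eq_integral[OF w] AE_I2)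
    show "AE x in leb_square. (\<lambda>n. ennreal ((g x - f n x)\<^sup>2)) \<longlonglongrightarrow> 0"
    proof (rule AE_I2)
      fix x assume "x \<in> space leb_square"
      from tendsto_diff[OF tendsto_const lim[OF this], of "g x"]
      have "(\<lambda>n. (g x - f n x)\<^sup>2) \<longlonglongrightarrow> 0" using tendsto_power[of _ 0 _ 2] by fastforce
      then show "(\<lambda>n. ennreal ((g x - f n x)\<^sup>2)) \<longlonglongrightarrow> 0"
        using tendsto_ennrealI by fastforce
    qed
    show "AE x in leb_square. ennreal ((g x - f n x)\<^sup>2) \<le> ennreal (w x)" for n
      using bd by (intro AE_I2 ennreal_leI) (simp add: power2_commute)
  qed (use w in auto)
  then have "\<forall>\<^sub>F n in sequentially. (\<integral>\<^sup>+x. ennreal ((g x - f n x)\<^sup>2) \<partial>leb_square) < ennreal \<epsilon>"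
    using \<open>\<epsilon> > 0\<close> by (intro order_tendstoD(2)) auto
  then show "\<exists>h\<in>L2_closure. (\<integral>\<^sup>+x. ennreal ((g x - h x)\<^sup>2) \<partial>leb_square) < ennreal \<epsilon>"
    using f by (auto simp: eventually_sequentially)
qed simp

lemma prob_space_leb_square: "prob_space leb_square"
proof -
  interpret prob_space leb01 by (rule prob_space_leb01)
  interpret pair_prob_space leb01 leb01 ..
  show ?thesis by unfold_locales
qed

lemma L2_closure_disjoint_union:
  assumes Q: "\<And>i::nat. Q i \<in> sets leb_square" "\<And>i. indicator (Q i) \<in> L2_closure"
    and disj: "disjoint_family Q"
  shows "indicator (\<Union>i. Q i) \<in> L2_closure"
proof (rule L2_closure_dominated)
  interpret prob_space leb_square by (rule prob_space_leb_square)
  have eq: "(\<Sum>i<n. indicator (Q i) x) = (indicator (\<Union>i<n. Q i) x :: real)" for n x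
    using disj by (intro indicator_UN_disjoint[symmetric]) (auto simp: disjoint_family_on_def)
  show "(\<lambda>x. \<Sum>i<n. indicator (Q i) x) \<in> L2_closure" for n
    by (intro L2_closure_sum Q)
  show "indicator (\<Union>i. Q i) \<in> borel_measurable leb_square" using Q(1) by auto
  show "integrable leb_square (\<lambda>_. 1)" by simp
  show "((\<Sum>i<n. indicator (Q i) x) - indicator (\<Union>i. Q i) x)\<^sup>2 \<le> (1::real)" for n x
    unfolding eq by (auto simp: indicator_def)
  show "(\<lambda>n. \<Sum>i<n. indicator (Q i) x) \<longlonglongrightarrow> (indicator (\<Union>i. Q i) x :: real)" for x
    unfolding eq by (rule LIMSEQ_indicator_UN)
qed

section \<open>Indicators of rectangles, of measurable sets, and square-integrable kernels\<close>

lemma L2_closure_indicator_rectangle_atMost: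
  assumes [measurable]: "B \<in> sets leb01"
  shows "indicator (({..a} \<inter> {0..1}) \<times> B) \<in> L2_closure"
proof (cases "0 \<le> a")
  case False
  then have empty: "({..a} \<inter> {0..1}) \<times> B = {}" by auto
  show ?thesis unfolding empty by (rule L2_closure_cong[OF L2_closure_zero]) simp
next
  case True
  interpret prob_space leb01 by (rule prob_space_leb01)
  have B01: "B \<subseteq> {0..1}" using sets.sets_into_space[OF assms] by simp
  \<comment> \<open>The kernel is built on (0,p], the rectangle on [0,p]; they differ only on the
    null line s = 0. Cutting \<open>a\<close> at 1 keeps the point inside [0,1].\<close>
  let ?h = "\<lambda>(s, \<eta>). elem_fun {min a 1} (\<lambda>p. indicator B \<eta>) s"
  have "?h \<in> elem_kernels"
    unfolding elem_kernels_def mem_Collect_eq using True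
    by (intro exI[of _ "{min a 1}"] exI[of _ "\<lambda>_. indicator B"] exI[of _ 1]) auto
  then have h: "?h \<in> L2_closure" by (rule L2_closure_elem)
  have sets: "{..a} \<inter> {0..1} \<in> sets leb01" "{0} \<in> sets leb01"
    by (auto simp: sets_restrict_space intro: image_eqI[of _ _ "{..a}"] image_eqI[of _ _ "{0}"])
  show ?thesis
  proof (rule L2_closureI)
    show "indicator (({..a} \<inter> {0..1}) \<times> B) \<in> borel_measurable leb_square"
      using sets by auto
    fix \<epsilon> :: real assume "\<epsilon> > 0"
    have "(\<integral>\<^sup>+x. ennreal ((indicator (({..a} \<inter> {0..1}) \<times> B) x - ?h x)\<^sup>2) \<partial>leb_square)
      \<le> (\<integral>\<^sup>+x. indicator ({0} \<times> space leb01) x \<partial>leb_square)"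
      using B01 by (intro nn_integral_mono)
        (auto simp: elem_singleton space_pair_measure indicator_def)
    also have "\<dots> = emeasure leb01 {0} * emeasure leb01 (space leb01)"
      using sets sets.top[of leb01] by (subst nn_integral_indicator) (auto intro: emeasure_pair_measure_Times)
    also have "emeasure leb01 {0} = 0" by (simp add: emeasure_restrict_space)
    finally have "(\<integral>\<^sup>+x. ennreal ((indicator (({..a} \<inter> {0..1}) \<times> B) x - ?h x)\<^sup>2) \<partial>leb_square) \<le> 0"
      by simp
    then show "\<exists>h\<in>L2_closure. (\<integral>\<^sup>+x. ennreal ((indicator (({..a} \<inter> {0..1}) \<times> B) x - h x)\<^sup>2) \<partial>leb_square) < ennreal \<epsilon>"
      using h \<open>\<epsilon> > 0\<close> by (intro bexI[OF _ h]) auto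
  qed
qed

lemma sets_leb01_Int:
  assumes "A \<in> sets borel"
  shows "A \<inter> {0..1} \<in> sets leb01"
  using assms by (auto simp: sets_restrict_space intro: image_eqI[of _ _ A])

text \<open>A Dynkin argument in the first factor with \<open>B\<close> fixed, starting from
  half-lines because they are stable under intersection and meet [0,1] in the sets that elementary
  kernels reach up to a null set.\<close>

lemma L2_closure_indicator_rectangle_borel:
  assumes B: "B \<in> sets leb01" and "A \<in> sets borel"
  shows "indicator ((A \<inter> {0..1}) \<times> B) \<in> L2_closure"
proof -
  have borel: "sets borel = sigma_sets UNIV (range (\<lambda>a::real. {..a}))"
    unfolding borel_eq_atMost by simp
  have "Int_stable (range (\<lambda>a::real. {..a}))"
    by (auto simp: Int_stable_def)
  moreover have "range (\<lambda>a::real. {..a}) \<subseteq> Pow UNIV" by simp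
  moreover have "A \<in> sigma_sets UNIV (range (\<lambda>a::real. {..a}))" using assms(2) borel by simp
  ultimately show ?thesis
  proof (induction rule: sigma_sets_induct_disjoint)
    case (basic A)
    then show ?case using L2_closure_indicator_rectangle_atMost[OF B] by auto
  next
    case empty
    show ?case by (rule L2_closure_cong[OF L2_closure_zero]) simp
  next
    case (compl A)
    \<comment> \<open>The half-line up to 1 represents all of [0,1], so the complement is a
      difference of two members.\<close>
    have "(\<lambda>x. indicator (({..1} \<inter> {0..1}) \<times> B) x - indicator ((A \<inter> {0..1}) \<times> B) x) \<in> L2_closure"
      by (intro L2_closure_diff L2_closure_indicator_rectangle_atMost compl B)
    then show ?case
      by (rule L2_closure_cong) (auto split: split_indicator)
  next
    case (union A)
    have "indicator (\<Union>i. (A i \<inter> {0..1}) \<times> B) \<in> L2_closure"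
    proof (rule L2_closure_disjoint_union)
      show "(A i \<inter> {0..1}) \<times> B \<in> sets leb_square" for i
        using union(2) B borel by (intro pair_measureI sets_leb01_Int) auto
      show "disjoint_family (\<lambda>i. (A i \<inter> {0..1}) \<times> B)"
        using union(1) by (auto simp: disjoint_family_on_def)
    qed (rule union)
    then show ?case
      by (rule L2_closure_cong) (auto split: split_indicator)
  qed
qed

text \<open>A second Dynkin argument, from rectangles to the product sigma-algebra. Its disjoint
  unions are sums of indicators, within reach of a linear space closed under dominated limits;
  general unions would call for products.\<close>

lemma L2_closure_indicator:
  assumes "Q \<in> sets leb_square"
  shows "indicator Q \<in> L2_closure"
proof -
  let ?G = "{a \<times> b | a b. a \<in> sets leb01 \<and> b \<in> sets leb01}"
  have rect: "indicator (A \<times> B) \<in> L2_closure" if "A \<in> sets leb01" "B \<in> sets leb01" for A B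
  proof -
    from that(1) obtain A' where "A' \<in> sets borel" "A = A' \<inter> {0..1}"
      by (auto simp: sets_restrict_space)
    with L2_closure_indicator_rectangle_borel[OF that(2)] show ?thesis by simp
  qed
  have sets: "sigma_sets (space leb01 \<times> space leb01) ?G = sets leb_square"
    by (rule sets_pair_measure[symmetric])
  have "Int_stable ?G" by (rule Int_stable_pair_measure_generator)
  moreover have "?G \<subseteq> Pow (space leb01 \<times> space leb01)" by (rule pair_measure_closed)
  moreover have "Q \<in> sigma_sets (space leb01 \<times> space leb01) ?G" using assms sets by simp
  ultimately show ?thesis
  proof (induction rule: sigma_sets_induct_disjoint)
    case (basic A)
    then show ?case using rect by auto
  next
    case empty
    show ?case by (rule L2_closure_cong[OF L2_closure_zero]) simp
  next
    case (compl A)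
    have "(\<lambda>x. indicator (space leb01 \<times> space leb01) x - indicator A x) \<in> L2_closure"
      by (intro L2_closure_diff rect compl sets.top)
    then show ?case
      by (rule L2_closure_cong) (auto simp: space_pair_measure split: split_indicator)
  next
    case (union A)
    then show ?case unfolding sets by (intro L2_closure_disjoint_union) auto
  qed
qed

lemma L2_closure_square_integrable:
  assumes [measurable]: "f \<in> borel_measurable leb_square" and f2: "integrable leb_square (\<lambda>x. (f x)\<^sup>2)"
  shows "f \<in> L2_closure"
proof -
  obtain F where F: "\<And>i. simple_function leb_square (F i)"
    "\<And>x. x \<in> space leb_square \<Longrightarrow> (\<lambda>i. F i x) \<longlonglongrightarrow> f x"
    "\<And>i x. x \<in> space leb_square \<Longrightarrow> dist (F i x) 0 \<le> 2 * dist (f x) 0"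
    using borel_measurable_implies_sequence_metric[OF assms(1), of 0] by blast
  have Fc: "F i \<in> L2_closure" for i
  proof (rule L2_closure_cong)
    show "(\<lambda>x. \<Sum>y\<in>F i ` space leb_square. y * indicator (F i -` {y} \<inter> space leb_square) x) \<in> L2_closure"
    proof (rule L2_closure_sum[where f="\<lambda>y x. y * indicator (F i -` {y} \<inter> space leb_square) x"])
      fix y
      have "F i -` {y} \<inter> space leb_square \<in> sets leb_square"
        using F(1) by (rule simple_functionD(2))
      from L2_closure_scale[OF L2_closure_indicator[OF this]]
      show "(\<lambda>x. y * indicator (F i -` {y} \<inter> space leb_square) x) \<in> L2_closure" .
    qed
    fix x assume "x \<in> space leb_square"
    from simple_function_indicator_representation_banach[OF F(1)[of i] this, symmetric]
    show "(\<Sum>y\<in>F i ` space leb_square. y * indicator (F i -` {y} \<inter> space leb_square) x) = F i x"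
      by (simp only: real_scaleR_def mult.commute)
  qed
  show ?thesis
  proof (rule L2_closure_dominated[OF Fc _ _ _ F(2)])
    \<comment> \<open>The simple functions satisfy |F i| <= 2 |f|, hence |F i - f| <= 3 |f|, and 9
      is the square of 3.\<close>
    show "integrable leb_square (\<lambda>x. 9 * (f x)\<^sup>2)" using f2 by simp
    fix i x assume "x \<in> space leb_square"
    from F(3)[OF this, of i] have "\<bar>F i x - f x\<bar> \<le> 3 * \<bar>f x\<bar>" by (simp add: dist_real_def)
    then have "(F i x - f x)\<^sup>2 \<le> (3 * \<bar>f x\<bar>)\<^sup>2" by (metis abs_ge_zero power2_abs power_mono)
    then show "(F i x - f x)\<^sup>2 \<le> 9 * (f x)\<^sup>2" by (simp add: power_mult_distrib)
  qed simp_all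
qed

lemma elem_kernel_sequence:
  assumes "f \<in> borel_measurable leb_square" "integrable leb_square (\<lambda>x. (f x)\<^sup>2)"
  obtains P :: "nat \<Rightarrow> real set" and g :: "nat \<Rightarrow> real \<Rightarrow> real \<Rightarrow> real" and C :: "nat \<Rightarrow> real"
  where "\<And>n. finite (P n)" "\<And>n. P n \<subseteq> {0..1}" "\<And>n p. g n p \<in> borel_measurable leb01"
    "\<And>n p \<eta>. \<bar>g n p \<eta>\<bar> \<le> C n"
    "\<And>n. (\<integral>\<^sup>+x. ennreal ((f x - (case x of (s, \<eta>) \<Rightarrow> elem_fun (P n) (\<lambda>p. g n p \<eta>) s))\<^sup>2) \<partial>leb_square)
      < ennreal (1 / Suc n)"
proof -
  have "f \<in> L2_closure" using assms by (rule L2_closure_square_integrable)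
  then have dense: "\<exists>h\<in>elem_kernels. (\<integral>\<^sup>+x. ennreal ((f x - h x)\<^sup>2) \<partial>leb_square) < ennreal (1 / Suc n)" for n
    unfolding L2_closure_def by simp
  have "\<forall>n. \<exists>P g C. finite P \<and> P \<subseteq> {0..1} \<and>
    (\<forall>p. g p \<in> borel_measurable leb01 \<and> (\<forall>\<eta>. \<bar>g p \<eta>\<bar> \<le> C)) \<and>
    (\<integral>\<^sup>+x. ennreal ((f x - (case x of (s, \<eta>) \<Rightarrow> elem_fun P (\<lambda>p. g p \<eta>) s))\<^sup>2) \<partial>leb_square) < ennreal (1 / Suc n)"
  proof
    fix n
    from dense[of n] obtain h where h: "h \<in> elem_kernels"
      "(\<integral>\<^sup>+x. ennreal ((f x - h x)\<^sup>2) \<partial>leb_square) < ennreal (1 / Suc n)" by blast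
    from h(1) obtain P g C where "finite P" "P \<subseteq> {0..1}" "\<And>p. g p \<in> borel_measurable leb01"
      "\<And>p \<eta>. \<bar>g p \<eta>\<bar> \<le> C" and eq: "h = (\<lambda>(s, \<eta>). elem_fun P (\<lambda>p. g p \<eta>) s)"
      by (rule elem_kernelsE) (rule that)
    then show "\<exists>P g C. finite P \<and> P \<subseteq> {0..1} \<and>
      (\<forall>p. g p \<in> borel_measurable leb01 \<and> (\<forall>\<eta>. \<bar>g p \<eta>\<bar> \<le> C)) \<and>
      (\<integral>\<^sup>+x. ennreal ((f x - (case x of (s, \<eta>) \<Rightarrow> elem_fun P (\<lambda>p. g p \<eta>) s))\<^sup>2) \<partial>leb_square) < ennreal (1 / Suc n)"
      using h(2)[unfolded eq] by (intro exI[of _ P] exI[of _ g] exI[of _ C] conjI allI)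
  qed
  from choice[OF this] obtain P where "\<forall>n. \<exists>g C. finite (P n) \<and> P n \<subseteq> {0..1} \<and>
    (\<forall>p. g p \<in> borel_measurable leb01 \<and> (\<forall>\<eta>. \<bar>g p \<eta>\<bar> \<le> C)) \<and>
    (\<integral>\<^sup>+x. ennreal ((f x - (case x of (s, \<eta>) \<Rightarrow> elem_fun (P n) (\<lambda>p. g p \<eta>) s))\<^sup>2) \<partial>leb_square) < ennreal (1 / Suc n)"
    by blast
  from choice[OF this] obtain g where "\<forall>n. \<exists>C. finite (P n) \<and> P n \<subseteq> {0..1} \<and>
    (\<forall>p. g n p \<in> borel_measurable leb01 \<and> (\<forall>\<eta>. \<bar>g n p \<eta>\<bar> \<le> C)) \<and>
    (\<integral>\<^sup>+x. ennreal ((f x - (case x of (s, \<eta>) \<Rightarrow> elem_fun (P n) (\<lambda>p. g n p \<eta>) s))\<^sup>2) \<partial>leb_square) < ennreal (1 / Suc n)"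
    by blast
  from choice[OF this] obtain C where "\<forall>n. finite (P n) \<and> P n \<subseteq> {0..1} \<and>
    (\<forall>p. g n p \<in> borel_measurable leb01 \<and> (\<forall>\<eta>. \<bar>g n p \<eta>\<bar> \<le> C n)) \<and>
    (\<integral>\<^sup>+x. ennreal ((f x - (case x of (s, \<eta>) \<Rightarrow> elem_fun (P n) (\<lambda>p. g n p \<eta>) s))\<^sup>2) \<partial>leb_square) < ennreal (1 / Suc n)"
    by blast
  then show ?thesis using that by blast
qed

section \<open>The transposed integral operator\<close>

text \<open>The adjoint of K in kernel form. It integrates the first variable, exactly as dw_s does,
  and so is what a drift with density \<phi> adds to the Wiener integral of k(s,\<eta>).\<close>

definition transpose_op :: "(real \<Rightarrow> real \<Rightarrow> real) \<Rightarrow> (real \<Rightarrow> real) \<Rightarrow> real \<Rightarrow> real"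
  where "transpose_op k \<phi> \<eta> = (\<integral>s. k s \<eta> * \<phi> s \<partial>leb01)"

lemma integrable_square_add:
  fixes f g :: "'a \<Rightarrow> real"
  assumes [measurable]: "f \<in> borel_measurable M" "g \<in> borel_measurable M"
    and "integrable M (\<lambda>x. (f x)\<^sup>2)" "integrable M (\<lambda>x. (g x)\<^sup>2)"
  shows "integrable M (\<lambda>x. (f x + g x)\<^sup>2)"
proof -
  have "integrable M (\<lambda>x. (f x)\<^sup>2 + (g x)\<^sup>2 + 2 * (f x * g x))"
    using assms integrable_mult_square[OF assms] by simp
  then show ?thesis by (simp add: power2_sum mult.assoc)
qed

lemma integrable_square_diff:
  fixes f g :: "'a \<Rightarrow> real"
  assumes "f \<in> borel_measurable M" "g \<in> borel_measurable M"
    and "integrable M (\<lambda>x. (f x)\<^sup>2)" "integrable M (\<lambda>x. (g x)\<^sup>2)"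
  shows "integrable M (\<lambda>x. (f x - g x)\<^sup>2)"
  using integrable_square_add[of f M "\<lambda>x. - g x"] assms by simp

lemma L2_01D:
  assumes "f \<in> L2_01"
  shows "f \<in> borel_measurable leb01" "integrable leb01 (\<lambda>x. (f x)\<^sup>2)"
  using assms by (auto simp: L2_01_def)

lemma L2_01_add: "f \<in> L2_01 \<Longrightarrow> g \<in> L2_01 \<Longrightarrow> (\<lambda>x. f x + g x) \<in> L2_01"
  unfolding L2_01_def using integrable_square_add by auto

lemma L2_01_diff: "f \<in> L2_01 \<Longrightarrow> g \<in> L2_01 \<Longrightarrow> (\<lambda>x. f x - g x) \<in> L2_01"
  unfolding L2_01_def using integrable_square_diff by auto

lemma L2_01_mult_integrable: "f \<in> L2_01 \<Longrightarrow> g \<in> L2_01 \<Longrightarrow> integrable leb01 (\<lambda>x. f x * g x)"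
  unfolding L2_01_def using integrable_mult_square by auto

text \<open>For a function that is not integrable the Bochner integral is 0 by default and the bound
  persists. Thus \<open>transpose_op\<close> can be estimated at every \<eta>, including those with
  a bad section.\<close>

lemma abs_integral_le_nn_integral:
  fixes f :: "'a \<Rightarrow> real"
  shows "ennreal \<bar>\<integral>x. f x \<partial>M\<bar> \<le> (\<integral>\<^sup>+x. ennreal \<bar>f x\<bar> \<partial>M)"
proof (cases "integrable M f")
  case True
  then show ?thesis using integral_norm_bound_ennreal[of M f] by simp
next
  case False
  then show ?thesis by (simp add: not_integrable_integral_eq)
qed

lemma integrable_nonneg_nn_integral_le:
  fixes f :: "'a \<Rightarrow> real"
  assumes "f \<in> borel_measurable M" "\<And>x. 0 \<le> f x" "(\<integral>\<^sup>+x. ennreal (f x) \<partial>M) \<le> ennreal c" "0 \<le> c"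
  shows "integrable M f" "(\<integral>x. f x \<partial>M) \<le> c"
proof -
  show *: "integrable M f"
    using assms by (intro integrableI_bounded) (auto simp: order_le_less_trans)
  have "ennreal (\<integral>x. f x \<partial>M) \<le> ennreal c"
    using assms nn_integral_eq_integral[OF *] by simp
  then show "(\<integral>x. f x \<partial>M) \<le> c" using assms(4) by simp
qed

lemma pair_leb01: "pair_sigma_finite leb01 leb01"
proof -
  interpret prob_space leb01 by (rule prob_space_leb01)
  show ?thesis ..
qed

lemma L2_kernel_sections:
  assumes "L2_kernel k"
  shows "AE \<eta> in leb01. (\<lambda>s. k s \<eta>) \<in> L2_01"
proof -
  interpret pair_sigma_finite leb01 leb01 by (rule pair_leb01)
  have [measurable]: "(\<lambda>(s, \<eta>). k s \<eta>) \<in> borel_measurable leb_square"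
    and int: "integrable leb_square (\<lambda>(s, \<eta>). (k s \<eta>)\<^sup>2)"
    using assms by (auto simp: L2_kernel_def)
  have "AE \<eta> in leb01. integrable leb01 (\<lambda>s. (k s \<eta>)\<^sup>2)"
    using AE_integrable_snd[OF int] by simp
  moreover have "AE \<eta> in leb01. (\<lambda>s. k s \<eta>) \<in> borel_measurable leb01"
    by (rule AE_I2) measurable
  ultimately show ?thesis by eventually_elim (simp add: L2_01_def)
qed

text \<open>Cauchy-Schwarz in s for fixed \<eta>, then integration over \<eta>: the Hilbert-Schmidt
  bound. For k it yields membership in L2; for the differences of step kernels and k, the bound
  tends to 0.\<close>

lemma transpose_op_bound:
  assumes k: "L2_kernel k" and \<phi>: "\<phi> \<in> L2_01"
  shows transpose_op_L2: "transpose_op k \<phi> \<in> L2_01"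
    and transpose_op_norm_le: "(\<integral>\<eta>. (transpose_op k \<phi> \<eta>)\<^sup>2 \<partial>leb01)
      \<le> (\<integral>x. (case x of (s, \<eta>) \<Rightarrow> (k s \<eta>)\<^sup>2) \<partial>leb_square) * (\<integral>s. (\<phi> s)\<^sup>2 \<partial>leb01)"
proof -
  interpret pair_sigma_finite leb01 leb01 by (rule pair_leb01)
  have [measurable]: "(\<lambda>(s, \<eta>). k s \<eta>) \<in> borel_measurable leb_square"
    and int: "integrable leb_square (\<lambda>(s, \<eta>). (k s \<eta>)\<^sup>2)"
    using k by (auto simp: L2_kernel_def)
  have [measurable]: "\<phi> \<in> borel_measurable leb01" and \<phi>2: "integrable leb01 (\<lambda>s. (\<phi> s)\<^sup>2)"
    using \<phi> by (auto simp: L2_01_def)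
  have [measurable]: "transpose_op k \<phi> \<in> borel_measurable leb01"
    unfolding transpose_op_def by measurable
  let ?K = "\<integral>x. (case x of (s, \<eta>) \<Rightarrow> (k s \<eta>)\<^sup>2) \<partial>leb_square" and ?P = "\<integral>s. (\<phi> s)\<^sup>2 \<partial>leb01"
  have "(\<integral>\<^sup>+\<eta>. ennreal ((transpose_op k \<phi> \<eta>)\<^sup>2) \<partial>leb01)
    \<le> (\<integral>\<^sup>+\<eta>. (\<integral>\<^sup>+s. ennreal ((k s \<eta>)\<^sup>2) \<partial>leb01) * ennreal ?P \<partial>leb01)"
  proof (rule nn_integral_mono)
    fix \<eta> assume [measurable]: "\<eta> \<in> space leb01"
    have "ennreal ((transpose_op k \<phi> \<eta>)\<^sup>2) = (ennreal \<bar>transpose_op k \<phi> \<eta>\<bar>)\<^sup>2"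
      by (simp add: ennreal_power)
    also have "\<dots> \<le> (\<integral>\<^sup>+s. ennreal \<bar>k s \<eta> * \<phi> s\<bar> \<partial>leb01)\<^sup>2"
      unfolding transpose_op_def by (intro power_mono abs_integral_le_nn_integral) simp
    also have "\<dots> = (\<integral>\<^sup>+s. ennreal \<bar>k s \<eta>\<bar> * ennreal \<bar>\<phi> s\<bar> \<partial>leb01)\<^sup>2"
      by (simp add: abs_mult ennreal_mult)
    also have "\<dots> \<le> (\<integral>\<^sup>+s. (ennreal \<bar>k s \<eta>\<bar>)\<^sup>2 \<partial>leb01) * (\<integral>\<^sup>+s. (ennreal \<bar>\<phi> s\<bar>)\<^sup>2 \<partial>leb01)"
      by (intro Cauchy_Schwarz_nn_integral) measurable
    also have "\<dots> = (\<integral>\<^sup>+s. ennreal ((k s \<eta>)\<^sup>2) \<partial>leb01) * ennreal ?P"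
      using \<phi>2 by (simp add: ennreal_power nn_integral_eq_integral)
    finally show "ennreal ((transpose_op k \<phi> \<eta>)\<^sup>2) \<le> (\<integral>\<^sup>+s. ennreal ((k s \<eta>)\<^sup>2) \<partial>leb01) * ennreal ?P" .
  qed
  also have "\<dots> = (\<integral>\<^sup>+\<eta>. \<integral>\<^sup>+s. (\<lambda>(s, \<eta>). ennreal ((k s \<eta>)\<^sup>2)) (s, \<eta>) \<partial>leb01 \<partial>leb01) * ennreal ?P"
    by (subst nn_integral_multc) simp_all
  also have "\<dots> = (\<integral>\<^sup>+x. (\<lambda>(s, \<eta>). ennreal ((k s \<eta>)\<^sup>2)) x \<partial>leb_square) * ennreal ?P"
    by (subst nn_integral_snd) simp_all
  also have "(\<integral>\<^sup>+x. (\<lambda>(s, \<eta>). ennreal ((k s \<eta>)\<^sup>2)) x \<partial>leb_square) = ennreal ?K"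
    using nn_integral_eq_integral[OF int] by (simp add: case_prod_unfold)
  also have "ennreal ?K * ennreal ?P = ennreal (?K * ?P)"
    by (simp add: ennreal_mult case_prod_unfold)
  finally have *: "(\<integral>\<^sup>+\<eta>. ennreal ((transpose_op k \<phi> \<eta>)\<^sup>2) \<partial>leb01) \<le> ennreal (?K * ?P)" .
  have nonneg: "0 \<le> ?K * ?P" by (intro mult_nonneg_nonneg Bochner_Integration.integral_nonneg) auto
  show "(\<integral>\<eta>. (transpose_op k \<phi> \<eta>)\<^sup>2 \<partial>leb01) \<le> ?K * ?P"
    by (rule integrable_nonneg_nn_integral_le(2)[OF _ _ * nonneg]) auto
  show "transpose_op k \<phi> \<in> L2_01"
    using integrable_nonneg_nn_integral_le(1)[OF _ _ * nonneg] by (simp add: L2_01_def)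
qed

section \<open>The adjoint of \<open>I + K\<close> and its isometry property\<close>

lemma kernel_op_transpose:
  assumes k: "L2_kernel k" and f: "f \<in> L2_01" and g: "g \<in> L2_01"
  shows "inner_01 (kernel_op k f) g = inner_01 f (transpose_op k g)"
proof -
  interpret pair_sigma_finite leb01 leb01 by (rule pair_leb01)
  have [measurable]: "(\<lambda>(s, \<eta>). k s \<eta>) \<in> borel_measurable leb_square"
    and int: "integrable leb_square (\<lambda>(s, \<eta>). (k s \<eta>)\<^sup>2)"
    using k by (auto simp: L2_kernel_def)
  have [measurable]: "f \<in> borel_measurable leb01" "g \<in> borel_measurable leb01"
    and f2: "integrable leb01 (\<lambda>s. (f s)\<^sup>2)" and g2: "integrable leb01 (\<lambda>s. (g s)\<^sup>2)"
    using f g by (auto simp: L2_01_def)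
  \<comment> \<open>Tonelli makes the product g(t) f(\<tau>) square integrable on the square;
    multiplied by the L2 kernel it becomes integrable, as Fubini requires.\<close>
  have fg: "integrable leb_square (\<lambda>(t, \<tau>). (g t * f \<tau>)\<^sup>2)"
  proof (rule integrable_nonneg_nn_integral_le(1))
    have "(\<integral>\<^sup>+x. ennreal (case x of (t, \<tau>) \<Rightarrow> (g t * f \<tau>)\<^sup>2) \<partial>leb_square)
      = (\<integral>\<^sup>+t. \<integral>\<^sup>+\<tau>. ennreal ((g t)\<^sup>2) * ennreal ((f \<tau>)\<^sup>2) \<partial>leb01 \<partial>leb01)"
      by (subst sigma_finite_measure.nn_integral_fst[symmetric, OF prob_space_imp_sigma_finite[OF prob_space_leb01]]) (auto simp: power_mult_distrib ennreal_mult)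
    also have "\<dots> = ennreal ((\<integral>t. (g t)\<^sup>2 \<partial>leb01) * (\<integral>\<tau>. (f \<tau>)\<^sup>2 \<partial>leb01))"
      using f2 g2 by (simp add: nn_integral_cmult nn_integral_multc nn_integral_eq_integral ennreal_mult)
    finally show "(\<integral>\<^sup>+x. ennreal (case x of (t, \<tau>) \<Rightarrow> (g t * f \<tau>)\<^sup>2) \<partial>leb_square)
      \<le> ennreal ((\<integral>t. (g t)\<^sup>2 \<partial>leb01) * (\<integral>\<tau>. (f \<tau>)\<^sup>2 \<partial>leb01))" by simp
  qed auto
  have "integrable leb_square (\<lambda>x. (\<lambda>(t, \<tau>). k t \<tau>) x * (\<lambda>(t, \<tau>). g t * f \<tau>) x)"
    using int fg by (intro integrable_mult_square) (auto simp: case_prod_unfold)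
  then have prod: "integrable leb_square (\<lambda>(t, \<tau>). k t \<tau> * (g t * f \<tau>))"
    by (simp add: case_prod_unfold)
  have "inner_01 (kernel_op k f) g = (\<integral>t. \<integral>\<tau>. k t \<tau> * (g t * f \<tau>) \<partial>leb01 \<partial>leb01)"
    unfolding inner_01_def kernel_op_def integral_mult_left_zero[symmetric]
    by (simp only: mult.assoc mult.commute mult.left_commute)
  also have "\<dots> = (\<integral>\<tau>. \<integral>t. k t \<tau> * (g t * f \<tau>) \<partial>leb01 \<partial>leb01)"
    by (rule Fubini_integral[OF prod, symmetric])
  also have "\<dots> = inner_01 f (transpose_op k g)"
    unfolding inner_01_def transpose_op_def integral_mult_right_zero[symmetric]
    by (simp only: mult.assoc mult.commute mult.left_commute)
  finally show ?thesis .
qed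

lemma inner_01_add_left: "f \<in> L2_01 \<Longrightarrow> g \<in> L2_01 \<Longrightarrow> h \<in> L2_01 \<Longrightarrow>
  inner_01 (\<lambda>x. f x + g x) h = inner_01 f h + inner_01 g h"
  unfolding inner_01_def by (simp add: distrib_right L2_01_mult_integrable)

lemma inner_01_diff_right: "f \<in> L2_01 \<Longrightarrow> g \<in> L2_01 \<Longrightarrow> h \<in> L2_01 \<Longrightarrow>
  inner_01 f (\<lambda>x. g x - h x) = inner_01 f g - inner_01 f h"
  unfolding inner_01_def by (simp add: right_diff_distrib L2_01_mult_integrable)

lemma inner_01_commute: "inner_01 f g = inner_01 g f"
  unfolding inner_01_def by (simp add: mult.commute)

lemma inner_01_cong_AE:
  assumes "f \<in> L2_01" "f' \<in> L2_01" "g \<in> L2_01" "g' \<in> L2_01"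
    and "AE x in leb01. f x = f' x" "AE x in leb01. g x = g' x"
  shows "inner_01 f g = inner_01 f' g'"
  unfolding inner_01_def
proof (rule integral_cong_AE)
  show "AE x in leb01. f x * g x = f' x * g' x" using assms(5,6) by eventually_elim simp
qed (use assms in \<open>auto simp: L2_01_def\<close>)

lemma inner_01_self_eq_0:
  assumes "f \<in> L2_01" "inner_01 f f = 0"
  shows "AE x in leb01. f x = 0"
proof -
  have "integrable leb01 (\<lambda>x. (f x)\<^sup>2)" "(\<integral>x. (f x)\<^sup>2 \<partial>leb01) = 0"
    using assms by (auto simp: L2_01_def inner_01_def power2_eq_square)
  then have "AE x in leb01. (f x)\<^sup>2 = 0"
    by (subst (asm) integral_nonneg_eq_0_iff_AE) auto
  then show ?thesis by simp
qed

lemma kernel_op_L2: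
  assumes "L2_kernel k" "f \<in> L2_01"
  shows "kernel_op k f \<in> L2_01"
proof -
  interpret pair_sigma_finite leb01 leb01 by (rule pair_leb01)
  have k: "(\<lambda>(s, \<eta>). k s \<eta>) \<in> borel_measurable leb_square"
      "integrable leb_square (\<lambda>(s, \<eta>). (k s \<eta>)\<^sup>2)"
    using assms(1) by (auto simp: L2_kernel_def)
  then have "L2_kernel (\<lambda>s \<eta>. k \<eta> s)"
    unfolding L2_kernel_def
    using measurable_pair_swap[OF k(1)] integrable_product_swap[OF k(2)] by (simp add: case_prod_unfold)
  from transpose_op_L2[OF this assms(2)] show ?thesis
    unfolding transpose_op_def kernel_op_def .
qed

text \<open>The adjoint \<open>B\<close> in \<open>unitary_01\<close> is known only by duality.
  Testing against the difference of \<open>B \<phi>\<close> and the explicit formula shows that they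
  agree almost everywhere. With A = I + K, the squared norm of B \<phi> is then the inner product of
  A (B \<phi>) with \<phi>, and A B = I finishes.\<close>

lemma unitary_transpose_isometry:
  assumes k: "L2_kernel k"
    and U: "unitary_01 (\<lambda>f t. f t + kernel_op k f t)"
    and \<phi>: "\<phi> \<in> L2_01"
  shows "(\<integral>\<eta>. (\<phi> \<eta> + transpose_op k \<phi> \<eta>)\<^sup>2 \<partial>leb01) = (\<integral>\<eta>. (\<phi> \<eta>)\<^sup>2 \<partial>leb01)"
proof -
  let ?A = "\<lambda>f t. f t + kernel_op k f t"
  let ?V = "\<lambda>\<eta>. \<phi> \<eta> + transpose_op k \<phi> \<eta>"
  from U obtain B where A: "\<And>f. f \<in> L2_01 \<Longrightarrow> ?A f \<in> L2_01"
    and B: "\<And>g. g \<in> L2_01 \<Longrightarrow> B g \<in> L2_01"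
    and adj: "\<And>f g. f \<in> L2_01 \<Longrightarrow> g \<in> L2_01 \<Longrightarrow> inner_01 (?A f) g = inner_01 f (B g)"
    and inv: "\<And>f. f \<in> L2_01 \<Longrightarrow> AE x in leb01. ?A (B f) x = f x"
    unfolding unitary_01_def adjoint_01_def by blast
  have V: "?V \<in> L2_01" by (intro L2_01_add \<phi> transpose_op_L2 k)
  have adjV: "inner_01 f (B \<phi>) = inner_01 f ?V" if f: "f \<in> L2_01" for f
  proof -
    have "inner_01 f (B \<phi>) = inner_01 f \<phi> + inner_01 (kernel_op k f) \<phi>"
      using adj[OF f \<phi>] inner_01_add_left[OF f kernel_op_L2[OF k f] \<phi>] by simp
    also have "\<dots> = inner_01 f \<phi> + inner_01 f (transpose_op k \<phi>)"
      by (simp add: kernel_op_transpose[OF k f \<phi>])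
    also have "\<dots> = inner_01 f ?V"
      using inner_01_add_left[OF \<phi> transpose_op_L2[OF k \<phi>] f] by (simp add: inner_01_commute)
    finally show ?thesis .
  qed
  let ?d = "\<lambda>x. B \<phi> x - ?V x"
  have d: "?d \<in> L2_01" by (intro L2_01_diff B \<phi> V)
  have "inner_01 ?d ?d = 0"
    using adjV[OF d] inner_01_diff_right[OF d B[OF \<phi>] V] by simp
  from inner_01_self_eq_0[OF d this] have eq: "AE x in leb01. ?V x = B \<phi> x"
    by eventually_elim simp
  have "inner_01 ?V ?V = inner_01 (B \<phi>) (B \<phi>)"
    by (rule inner_01_cong_AE) (use V B[OF \<phi>] eq in auto)
  also have "\<dots> = inner_01 (?A (B \<phi>)) \<phi>" using adj[OF B[OF \<phi>] \<phi>] by simp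
  also have "\<dots> = inner_01 \<phi> \<phi>"
    by (rule inner_01_cong_AE) (use A[OF B[OF \<phi>]] \<phi> inv[OF \<phi>] in auto)
  finally show ?thesis by (simp add: inner_01_def power2_eq_square)
qed

lemma elem_kernel_approximation:
  assumes "L2_kernel k"
  obtains P :: "nat \<Rightarrow> real set" and g :: "nat \<Rightarrow> real \<Rightarrow> real \<Rightarrow> real" and C :: "nat \<Rightarrow> real"
  where "\<And>n. finite (P n)" "\<And>n. P n \<subseteq> {0..1}" "\<And>n p. g n p \<in> borel_measurable leb01"
    "\<And>n p \<eta>. \<bar>g n p \<eta>\<bar> \<le> C n"
    "\<And>n. L2_kernel (\<lambda>s \<eta>. elem_fun (P n) (\<lambda>p. g n p \<eta>) s - k s \<eta>)"
    "\<And>n. (\<integral>x. (case x of (s, \<eta>) \<Rightarrow> (elem_fun (P n) (\<lambda>p. g n p \<eta>) s - k s \<eta>)\<^sup>2) \<partial>leb_square) \<le> 1 / Suc n"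
proof -
  have k: "(\<lambda>(s, \<eta>). k s \<eta>) \<in> borel_measurable leb_square"
      "integrable leb_square (\<lambda>x. ((\<lambda>(s, \<eta>). k s \<eta>) x)\<^sup>2)"
    using assms by (auto simp: L2_kernel_def case_prod_unfold)
  show ?thesis
  proof (rule elem_kernel_sequence[OF k])
    fix P :: "nat \<Rightarrow> real set" and g :: "nat \<Rightarrow> real \<Rightarrow> real \<Rightarrow> real" and C :: "nat \<Rightarrow> real"
    assume P: "\<And>n. finite (P n)" "\<And>n. P n \<subseteq> {0..1}"
      "\<And>n p. g n p \<in> borel_measurable leb01" "\<And>n p \<eta>. \<bar>g n p \<eta>\<bar> \<le> C n"
      and lt: "\<And>n. (\<integral>\<^sup>+x. ennreal (((\<lambda>(s, \<eta>). k s \<eta>) x - (case x of (s, \<eta>) \<Rightarrow> elem_fun (P n) (\<lambda>p. g n p \<eta>) s))\<^sup>2) \<partial>leb_square)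
      < ennreal (1 / Suc n)"
    have meas: "(\<lambda>(s, \<eta>). elem_fun (P n) (\<lambda>p. g n p \<eta>) s) \<in> borel_measurable leb_square" for n
      by (rule elem_kernels_measurable, unfold elem_kernels_def,
          intro CollectI exI[of _ "P n"] exI[of _ "g n"] exI[of _ "C n"]) (use P in auto)
    let ?d = "\<lambda>n s \<eta>. elem_fun (P n) (\<lambda>p. g n p \<eta>) s - k s \<eta>"
    have dm: "(\<lambda>(s, \<eta>). ?d n s \<eta>) \<in> borel_measurable leb_square" for n
      using borel_measurable_diff[OF meas k(1)] by (simp add: case_prod_unfold)
    then have dm2: "(\<lambda>(s, \<eta>). (?d n s \<eta>)\<^sup>2) \<in> borel_measurable leb_square" for n
      using borel_measurable_power[OF dm, of 2] by (simp add: case_prod_unfold)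
    have le: "(\<integral>\<^sup>+x. ennreal (case x of (s, \<eta>) \<Rightarrow> (?d n s \<eta>)\<^sup>2) \<partial>leb_square) \<le> ennreal (1 / Suc n)" for n
      using less_imp_le[OF lt[of n]] by (simp add: case_prod_unfold power2_commute)
    have "integrable leb_square (\<lambda>(s, \<eta>). (?d n s \<eta>)\<^sup>2)" for n
      by (rule integrable_nonneg_nn_integral_le(1)[OF dm2 _ le]) auto
    then have "L2_kernel (?d n)" for n
      using dm by (simp add: L2_kernel_def)
    moreover have "(\<integral>x. (case x of (s, \<eta>) \<Rightarrow> (?d n s \<eta>)\<^sup>2) \<partial>leb_square) \<le> 1 / Suc n" for n
      by (rule integrable_nonneg_nn_integral_le(2)[OF dm2 _ le]) auto
    ultimately show ?thesis by (intro that[of P g C] P)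
  qed
qed

section \<open>Pathwise shift of elementary integrals\<close>

lemma integral_Icc_eq_Ioc_leb01:
  fixes \<phi> :: "real \<Rightarrow> real"
  assumes "p \<in> {0..1}" and [measurable]: "\<phi> \<in> borel_measurable leb01"
  shows "(LINT \<eta>:{0..p}|lborel. \<phi> \<eta>) = (\<integral>s. indicator {0<..p} s * \<phi> s \<partial>leb01)"
proof -
  have "(LINT \<eta>:{0..p}|lborel. \<phi> \<eta>) = (\<integral>s. indicator {0..p} s * \<phi> s \<partial>leb01)"
    unfolding set_lebesgue_integral_def using assms(1)
    by (subst Bochner_Integration.integral_restrict_space) (auto intro!: Bochner_Integration.integral_cong split: split_indicator)
  also have "\<dots> = (\<integral>s. indicator {0<..p} s * \<phi> s \<partial>leb01)"
  proof (rule integral_cong_AE)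
    have "AE s in leb01. s \<noteq> 0"
      by (subst AE_restrict_space_iff) (use AE_lborel_singleton[of "0::real"] in auto)
    then show "AE s in leb01. indicator {0..p} s * \<phi> s = indicator {0<..p} s * \<phi> s"
      by eventually_elim (auto simp: indicator_def)
  qed measurable
  finally show ?thesis .
qed

lemma integrable_indicator_mult_leb01:
  fixes \<phi> :: "real \<Rightarrow> real"
  assumes "integrable leb01 \<phi>"
  shows "integrable leb01 (\<lambda>s. indicator {0<..p} s * \<phi> s)"
proof (rule Bochner_Integration.integrable_bound[OF assms])
  have [measurable]: "\<phi> \<in> borel_measurable leb01" using assms by simp
  show "(\<lambda>s. indicator {0<..p} s * \<phi> s) \<in> borel_measurable leb01" by measurable
qed (auto simp: indicator_def)

text \<open>Purely deterministic: at each point p the path moves by the integral of \<phi> over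
  (0,p], and the finite combination of these indicators is \<open>elem_fun\<close>. With v = T w it
  replaces a stochastic calculus rule for d(Tw).\<close>

lemma elem_int_integral_shift:
  fixes \<phi> :: "real \<Rightarrow> real"
  assumes P: "P \<subseteq> {0..1}" and \<phi>: "integrable leb01 \<phi>"
    and v: "\<And>t. t \<in> {0..1} \<Longrightarrow> v t = w t + (LINT \<eta>:{0..t}|lborel. \<phi> \<eta>)"
  shows "elem_int P c v = elem_int P c w + (\<integral>s. elem_fun P c s * \<phi> s \<partial>leb01)"
proof -
  have [measurable]: "\<phi> \<in> borel_measurable leb01" using \<phi> by simp
  have "elem_int P c v = (\<Sum>p\<in>P. c p * w p + c p * (\<integral>s. indicator {0<..p} s * \<phi> s \<partial>leb01))"
    unfolding elem_int_def using P
    by (intro sum.cong refl) (auto simp: v integral_Icc_eq_Ioc_leb01 distrib_left)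
  also have "\<dots> = elem_int P c w + (\<Sum>p\<in>P. (\<integral>s. c p * (indicator {0<..p} s * \<phi> s) \<partial>leb01))"
    by (simp add: elem_int_def sum.distrib)
  also have "(\<Sum>p\<in>P. (\<integral>s. c p * (indicator {0<..p} s * \<phi> s) \<partial>leb01))
    = (\<integral>s. (\<Sum>p\<in>P. c p * (indicator {0<..p} s * \<phi> s)) \<partial>leb01)"
    by (rule Bochner_Integration.integral_sum[symmetric])
       (intro integrable_mult_right integrable_indicator_mult_leb01 \<phi>)
  also have "\<dots> = (\<integral>s. elem_fun P c s * \<phi> s \<partial>leb01)"
    unfolding elem_fun_def sum_distrib_right by (simp only: mult.assoc)
  finally show ?thesis .
qed

lemma integrable_bounded_leb01:
  fixes f :: "real \<Rightarrow> real"
  assumes "f \<in> borel_measurable leb01" "\<And>\<eta>. \<bar>f \<eta>\<bar> \<le> B"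
  shows "integrable leb01 f" "f \<in> L2_01"
proof -
  interpret prob_space leb01 by (rule prob_space_leb01)
  show "integrable leb01 f"
    using assms by (intro integrable_const_bound[of _ B]) auto
  have "integrable leb01 (\<lambda>x. (f x)\<^sup>2)"
    using assms power_mono[OF assms(2) abs_ge_zero, of _ 2]
    by (intro integrable_const_bound[of _ "B\<^sup>2"]) auto
  then show "f \<in> L2_01" using assms(1) by (simp add: L2_01_def)
qed

text \<open>The bound depends on \<open>w\<close> but exists for every \<open>w\<close>, with no
  exceptional set, as needed at T w.\<close>

lemma elem_int_L2_01:
  assumes "finite P" "\<And>p. g p \<in> borel_measurable leb01" "\<And>p \<eta>. \<bar>g p \<eta>\<bar> \<le> C"
  shows "(\<lambda>\<eta>. elem_int P (\<lambda>p. g p \<eta>) w) \<in> L2_01"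
proof (rule integrable_bounded_leb01(2))
  show "(\<lambda>\<eta>. elem_int P (\<lambda>p. g p \<eta>) w) \<in> borel_measurable leb01"
    unfolding elem_int_def using assms(2) by measurable
  show "\<bar>elem_int P (\<lambda>p. g p \<eta>) w\<bar> \<le> (\<Sum>p\<in>P. C * \<bar>w p\<bar>)" for \<eta>
    unfolding elem_int_def using assms(3)
    by (intro order_trans[OF sum_abs] sum_mono) (auto simp: abs_mult intro: mult_right_mono)
qed

section \<open>The invariant functional\<close>

lemma tendsto_zero_le_inverse_Suc:
  fixes f :: "nat \<Rightarrow> real"
  assumes "\<And>n. 0 \<le> f n" "\<And>n. f n \<le> c / real (Suc n)"
  shows "f \<longlonglongrightarrow> 0"
proof (rule tendsto_sandwich[OF _ _ tendsto_const])
  show "(\<lambda>n. c / real (Suc n)) \<longlonglongrightarrow> 0"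
    using tendsto_mult[OF tendsto_const[of c] LIMSEQ_Suc[OF lim_1_over_n]] by simp
  show "\<forall>\<^sub>F n in sequentially. f n \<le> c / real (Suc n)"
    using assms(2) by (intro always_eventually allI)
qed (use assms(1) in simp)

lemma integral_square_add_le:
  assumes a: "a \<in> L2_01" and b: "b \<in> L2_01"
  shows "(\<integral>x. (a x + b x)\<^sup>2 \<partial>leb01) \<le> 2 * (\<integral>x. (a x)\<^sup>2 \<partial>leb01) + 2 * (\<integral>x. (b x)\<^sup>2 \<partial>leb01)"
proof -
  have "(\<integral>x. (a x + b x)\<^sup>2 \<partial>leb01) \<le> (\<integral>x. 2 * (a x)\<^sup>2 + 2 * (b x)\<^sup>2 \<partial>leb01)"
  proof (rule integral_mono)
    show "(a x + b x)\<^sup>2 \<le> 2 * (a x)\<^sup>2 + 2 * (b x)\<^sup>2" for x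
      using sum_squares_bound[of "a x" "b x"] by (simp add: power2_sum)
  qed (use L2_01D(2)[OF a] L2_01D(2)[OF b] L2_01D(2)[OF L2_01_add[OF a b]] in auto)
  then show ?thesis
    using L2_01D(2)[OF a] L2_01D(2)[OF b] by simp
qed

text \<open>
  \<open>\<Phi> w \<eta>\<close> is the version of \<open>\<integral> k(s,\<eta>) dw\<^sub>s\<close> from the definition of \<open>T\<close>; the step kernels
  \<open>\<Sum>\<^sub>p g n p \<eta> 1\<^bsub>(0,p]\<^esub>(s)\<close> converge to \<open>k\<close> in \<open>L\<^sup>2([0,1]\<^sup>2)\<close>.
\<close>

locale wiener_integral_approximation = wiener_measure \<mu> for \<mu> +
  fixes k :: "real \<Rightarrow> real \<Rightarrow> real" and \<Phi> :: "(real \<Rightarrow> real) \<Rightarrow> real \<Rightarrow> real"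
    and P :: "nat \<Rightarrow> real set" and g :: "nat \<Rightarrow> real \<Rightarrow> real \<Rightarrow> real" and C :: "nat \<Rightarrow> real"
  assumes k: "L2_kernel k"
    and \<Phi>_measurable [measurable]: "(\<lambda>(w, \<eta>). \<Phi> w \<eta>) \<in> borel_measurable (\<mu> \<Otimes>\<^sub>M leb01)"
    and \<Phi>_wiener: "AE \<eta> in leb01. is_wiener_integral \<mu> (\<lambda>s. k s \<eta>) (\<lambda>w. \<Phi> w \<eta>)"
    and P: "finite (P n)" "P n \<subseteq> {0..1}"
    and g_measurable [measurable]: "g n p \<in> borel_measurable leb01"
    and g_bound: "\<bar>g n p \<eta>\<bar> \<le> C n"
    and kernel_diff: "L2_kernel (\<lambda>s \<eta>. elem_fun (P n) (\<lambda>p. g n p \<eta>) s - k s \<eta>)"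
    and kernel_diff_le: "(\<integral>x. (case x of (s, \<eta>) \<Rightarrow> (elem_fun (P n) (\<lambda>p. g n p \<eta>) s - k s \<eta>)\<^sup>2) \<partial>leb_square)
      \<le> 1 / Suc n"
begin

text \<open>The Wiener integral of the n-th step kernel. Unlike \<Phi> it is a formula in the values
  of the path, so it means something at T w as well.\<close>

definition \<Psi> :: "nat \<Rightarrow> (real \<Rightarrow> real) \<Rightarrow> real \<Rightarrow> real"
  where "\<Psi> n w \<eta> = elem_int (P n) (\<lambda>p. g n p \<eta>) w"

definition error :: "nat \<Rightarrow> (real \<Rightarrow> real) \<Rightarrow> real"
  where "error n w = (\<integral>\<eta>. (\<Psi> n w \<eta> - \<Phi> w \<eta>)\<^sup>2 \<partial>leb01)"

definition energy :: "nat \<Rightarrow> (real \<Rightarrow> real) \<Rightarrow> real"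
  where "energy n w = (\<integral>\<eta>. (\<Psi> n w \<eta>)\<^sup>2 \<partial>leb01)"

lemma pair_wiener_leb01: "pair_sigma_finite \<mu> leb01"
proof -
  interpret I: prob_space leb01 by (rule prob_space_leb01)
  show ?thesis ..
qed

lemma \<Psi>_measurable [measurable]: "(\<lambda>(w, \<eta>). \<Psi> n w \<eta>) \<in> borel_measurable (\<mu> \<Otimes>\<^sub>M leb01)"
proof -
  have [measurable]: "(\<lambda>w. w p) \<in> borel_measurable \<mu>" if "p \<in> P n" for p
    using P(2)[of n] that by auto
  show ?thesis unfolding \<Psi>_def elem_int_def split_beta
    by (intro borel_measurable_sum) measurable
qed

lemma \<Psi>_L2: "\<Psi> n w \<in> L2_01"
  unfolding \<Psi>_def by (rule elem_int_L2_01[OF P(1) g_measurable g_bound])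

text \<open>\<open>is_wiener_integral_elem_le\<close> applies for almost every \<eta> and is
  integrated over \<eta> by Tonelli; the 4 comes from there, the 1 / (n+1) from the choice of the
  step kernels.\<close>

lemma \<Psi>_error:
  shows \<Psi>_error_integrable: "integrable (\<mu> \<Otimes>\<^sub>M leb01) (\<lambda>(w, \<eta>). (\<Psi> n w \<eta> - \<Phi> w \<eta>)\<^sup>2)"
    and \<Psi>_error_le: "(\<integral>x. (case x of (w, \<eta>) \<Rightarrow> (\<Psi> n w \<eta> - \<Phi> w \<eta>)\<^sup>2) \<partial>(\<mu> \<Otimes>\<^sub>M leb01)) \<le> 4 / Suc n"
proof -
  interpret W: pair_sigma_finite \<mu> leb01 by (rule pair_wiener_leb01)
  interpret L: pair_sigma_finite leb01 leb01 by (rule pair_leb01)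
  let ?d = "\<lambda>s \<eta>. elem_fun (P n) (\<lambda>p. g n p \<eta>) s - k s \<eta>"
  have [measurable]: "(\<lambda>(s, \<eta>). ?d s \<eta>) \<in> borel_measurable leb_square"
    and int: "integrable leb_square (\<lambda>(s, \<eta>). (?d s \<eta>)\<^sup>2)"
    using kernel_diff[of n] by (simp_all only: L2_kernel_def)
  have "(\<integral>\<^sup>+x. ennreal (case x of (w, \<eta>) \<Rightarrow> (\<Psi> n w \<eta> - \<Phi> w \<eta>)\<^sup>2) \<partial>(\<mu> \<Otimes>\<^sub>M leb01))
    = (\<integral>\<^sup>+\<eta>. \<integral>\<^sup>+w. ennreal ((\<Psi> n w \<eta> - \<Phi> w \<eta>)\<^sup>2) \<partial>\<mu> \<partial>leb01)"
    by (subst W.nn_integral_snd[symmetric]) auto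
  also have "\<dots> \<le> (\<integral>\<^sup>+\<eta>. 4 * (\<integral>\<^sup>+s. ennreal ((?d s \<eta>)\<^sup>2) \<partial>leb01) \<partial>leb01)"
  proof (rule nn_integral_mono_AE)
    show "AE \<eta> in leb01. (\<integral>\<^sup>+w. ennreal ((\<Psi> n w \<eta> - \<Phi> w \<eta>)\<^sup>2) \<partial>\<mu>)
      \<le> 4 * (\<integral>\<^sup>+s. ennreal ((?d s \<eta>)\<^sup>2) \<partial>leb01)"
      using \<Phi>_wiener
    proof eventually_elim
      case (elim \<eta>)
      from is_wiener_integral_elem_le[OF elim P, of n "\<lambda>p. g n p \<eta>"]
      show ?case by (simp add: \<Psi>_def power2_commute)
    qed
  qed
  also have "\<dots> = 4 * (\<integral>\<^sup>+\<eta>. \<integral>\<^sup>+s. ennreal ((?d s \<eta>)\<^sup>2) \<partial>leb01 \<partial>leb01)"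
    by (rule nn_integral_cmult) measurable
  also have "(\<integral>\<^sup>+\<eta>. \<integral>\<^sup>+s. ennreal ((?d s \<eta>)\<^sup>2) \<partial>leb01 \<partial>leb01)
    = (\<integral>\<^sup>+x. ennreal (case x of (s, \<eta>) \<Rightarrow> (?d s \<eta>)\<^sup>2) \<partial>leb_square)"
    by (subst L.nn_integral_snd[symmetric]) auto
  also have "\<dots> = ennreal (\<integral>x. (case x of (s, \<eta>) \<Rightarrow> (?d s \<eta>)\<^sup>2) \<partial>leb_square)"
    by (rule nn_integral_eq_integral[OF int]) auto
  also have "4 * \<dots> \<le> 4 * ennreal (1 / Suc n)"
    by (intro mult_left_mono ennreal_leI kernel_diff_le) simp
  also have "\<dots> = ennreal (4 / Suc n)"
    using ennreal_mult[of 4 "1 / Suc n"] by simp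
  finally have le: "(\<integral>\<^sup>+x. ennreal (case x of (w, \<eta>) \<Rightarrow> (\<Psi> n w \<eta> - \<Phi> w \<eta>)\<^sup>2) \<partial>(\<mu> \<Otimes>\<^sub>M leb01)) \<le> ennreal (4 / Suc n)" .
  show "integrable (\<mu> \<Otimes>\<^sub>M leb01) (\<lambda>(w, \<eta>). (\<Psi> n w \<eta> - \<Phi> w \<eta>)\<^sup>2)"
    by (rule integrable_nonneg_nn_integral_le(1)[OF _ _ le]) auto
  show "(\<integral>x. (case x of (w, \<eta>) \<Rightarrow> (\<Psi> n w \<eta> - \<Phi> w \<eta>)\<^sup>2) \<partial>(\<mu> \<Otimes>\<^sub>M leb01)) \<le> 4 / Suc n"
    by (rule integrable_nonneg_nn_integral_le(2)[OF _ _ le]) auto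
qed

lemma error_integrable: "integrable \<mu> (error n)"
  and error_integral_le: "expectation (error n) \<le> 4 / Suc n"
proof -
  interpret W: pair_sigma_finite \<mu> leb01 by (rule pair_wiener_leb01)
  show "integrable \<mu> (error n)"
    using W.integrable_fst[OF \<Psi>_error_integrable[of n]] unfolding error_def .
  show "expectation (error n) \<le> 4 / Suc n"
    using W.integral_fst[OF \<Psi>_error_integrable[of n]] \<Psi>_error_le[of n] unfolding error_def by simp
qed

lemma error_nonneg: "0 \<le> error n w"
  unfolding error_def by simp

lemma \<Phi>_path_measurable: "w \<in> space \<mu> \<Longrightarrow> \<Phi> w \<in> borel_measurable leb01"
  using measurable_compose_Pair1[OF _ \<Phi>_measurable] by simp

text \<open>\<Phi> is \<Psi>_0 minus their difference: the first is in L2 at every path, the second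
  at almost every path by the error estimate.\<close>

lemma AE_\<Phi>_L2: "AE w in \<mu>. \<Phi> w \<in> L2_01"
proof -
  interpret W: pair_sigma_finite \<mu> leb01 by (rule pair_wiener_leb01)
  have "AE w in \<mu>. integrable leb01 (\<lambda>\<eta>. (\<Psi> 0 w \<eta> - \<Phi> w \<eta>)\<^sup>2)"
    using W.AE_integrable_fst[OF \<Psi>_error_integrable[of 0]] by simp
  then show ?thesis
    using AE_space
  proof eventually_elim
    case (elim w)
    then have "(\<lambda>\<eta>. \<Psi> 0 w \<eta> - \<Phi> w \<eta>) \<in> L2_01"
      using \<Phi>_path_measurable[of w] \<Psi>_L2[of 0 w] by (auto simp: L2_01_def)
    from L2_01_diff[OF \<Psi>_L2[of 0 w] this] show ?case by simp
  qed
qed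

text \<open>Convergence in mean gives pathwise convergence only along a subsequence. One
  \<open>r\<close> serves almost all paths, so a single measurable functional can be defined from
  it.\<close>

lemma AE_error_subsequence:
  obtains r :: "nat \<Rightarrow> nat" where "strict_mono r" "AE w in \<mu>. (\<lambda>n. error (r n) w) \<longlonglongrightarrow> 0"
proof -
  have "(\<lambda>n. expectation (\<lambda>w. norm (error n w))) \<longlonglongrightarrow> 0"
    using error_integral_le
    by (intro tendsto_zero_le_inverse_Suc[where c=4]) (simp_all add: error_nonneg del: of_nat_Suc)
  from tendsto_L1_AE_subseq[OF error_integrable this] show ?thesis
    using that by auto
qed

lemma energy_measurable [measurable]: "energy n \<in> borel_measurable \<mu>"
proof -
  interpret I: prob_space leb01 by (rule prob_space_leb01)
  show ?thesis unfolding energy_def by measurable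
qed

lemma energy_tendsto:
  assumes w: "\<Phi> w \<in> L2_01" and r: "(\<lambda>n. error (r n) w) \<longlonglongrightarrow> 0"
  shows "(\<lambda>n. energy (r n) w) \<longlonglongrightarrow> (\<integral>\<eta>. (\<Phi> w \<eta>)\<^sup>2 \<partial>leb01)"
  unfolding energy_def
proof (rule L2_norm_tendsto)
  show "integrable leb01 (\<lambda>\<eta>. (\<Psi> (r n) w \<eta> - \<Phi> w \<eta>)\<^sup>2)" for n
    using L2_01_diff[OF \<Psi>_L2 w] by (simp add: L2_01_def)
  show "(\<lambda>n. \<integral>\<eta>. (\<Psi> (r n) w \<eta> - \<Phi> w \<eta>)\<^sup>2 \<partial>leb01) \<longlonglongrightarrow> 0"
    using r unfolding error_def .
qed (use w \<Psi>_L2 in \<open>auto simp: L2_01_def\<close>)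

text \<open>With h_n the step kernel, \<Psi>_n(v) minus its limit splits into \<Psi>_n(w) -
  \<Phi>(w) and the transpose of h_n - k applied to \<Phi>(w). The first part is measured by
  \<open>error n w\<close>, the second by \<open>transpose_op_norm_le\<close>, so convergence at v
  is paid for entirely at w.\<close>

lemma energy_shift_tendsto:
  assumes w: "\<Phi> w \<in> L2_01" and r: "strict_mono r" "(\<lambda>n. error (r n) w) \<longlonglongrightarrow> 0"
    and v: "\<And>t. t \<in> {0..1} \<Longrightarrow> v t = w t + (LINT \<eta>:{0..t}|lborel. \<Phi> w \<eta>)"
  shows "(\<lambda>n. energy (r n) v) \<longlonglongrightarrow> (\<integral>\<eta>. (\<Phi> w \<eta> + transpose_op k (\<Phi> w) \<eta>)\<^sup>2 \<partial>leb01)"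
  unfolding energy_def
proof (rule L2_norm_tendsto)
  interpret I: prob_space leb01 by (rule prob_space_leb01)
  let ?V = "\<lambda>\<eta>. \<Phi> w \<eta> + transpose_op k (\<Phi> w) \<eta>"
  let ?d = "\<lambda>n s \<eta>. elem_fun (P n) (\<lambda>p. g n p \<eta>) s - k s \<eta>"
  let ?D = "\<lambda>n. transpose_op (?d n) (\<Phi> w)"
  let ?c = "\<integral>s. (\<Phi> w s)\<^sup>2 \<partial>leb01"
  have V: "?V \<in> L2_01" by (intro L2_01_add w transpose_op_L2 k)
  have int: "integrable leb01 (\<Phi> w)"
    using w by (auto simp: L2_01_def intro: I.square_integrable_imp_integrable[of "\<Phi> w"])
  show "?V \<in> borel_measurable leb01" "integrable leb01 (\<lambda>\<eta>. (?V \<eta>)\<^sup>2)"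
    using V by (auto simp: L2_01_def)
  show "\<Psi> (r n) v \<in> borel_measurable leb01" for n
    using \<Psi>_L2 by (auto simp: L2_01_def)
  show "integrable leb01 (\<lambda>\<eta>. (\<Psi> (r n) v \<eta> - ?V \<eta>)\<^sup>2)" for n
    using L2_01_diff[OF \<Psi>_L2 V] by (simp add: L2_01_def)
  have le: "(\<integral>\<eta>. (\<Psi> n v \<eta> - ?V \<eta>)\<^sup>2 \<partial>leb01) \<le> 2 * error n w + 2 * (1 / Suc n * ?c)" for n
  proof -
    have D: "?D n \<in> L2_01" by (rule transpose_op_L2[OF kernel_diff w])
    have E: "(\<lambda>\<eta>. \<Psi> n w \<eta> - \<Phi> w \<eta>) \<in> L2_01" by (rule L2_01_diff[OF \<Psi>_L2 w])
    have D_le: "(\<integral>\<eta>. (?D n \<eta>)\<^sup>2 \<partial>leb01) \<le> 1 / Suc n * ?c"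
      by (rule order_trans[OF transpose_op_norm_le[OF kernel_diff w]], rule mult_right_mono[OF kernel_diff_le])
         simp
    have "(\<integral>\<eta>. (\<Psi> n v \<eta> - ?V \<eta>)\<^sup>2 \<partial>leb01) = (\<integral>\<eta>. ((\<Psi> n w \<eta> - \<Phi> w \<eta>) + ?D n \<eta>)\<^sup>2 \<partial>leb01)"
    proof (rule integral_cong_AE)
      show "AE \<eta> in leb01. (\<Psi> n v \<eta> - ?V \<eta>)\<^sup>2 = ((\<Psi> n w \<eta> - \<Phi> w \<eta>) + ?D n \<eta>)\<^sup>2"
        \<comment> \<open>Where a section fails to be in L2 the integrals below may take the default
          value 0 and need not add up; such \<eta> form a null set.\<close>
        using L2_kernel_sections[OF k] L2_kernel_sections[OF kernel_diff[of n]]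
      proof eventually_elim
        case (elim \<eta>)
        have "(\<integral>s. elem_fun (P n) (\<lambda>p. g n p \<eta>) s * \<Phi> w s \<partial>leb01)
          = (\<integral>s. k s \<eta> * \<Phi> w s + ?d n s \<eta> * \<Phi> w s \<partial>leb01)"
          by (simp add: algebra_simps)
        also have "\<dots> = transpose_op k (\<Phi> w) \<eta> + ?D n \<eta>"
          unfolding transpose_op_def
          by (intro Bochner_Integration.integral_add L2_01_mult_integrable elim w)
        finally have "\<Psi> n v \<eta> = \<Psi> n w \<eta> + (transpose_op k (\<Phi> w) \<eta> + ?D n \<eta>)"
          unfolding \<Psi>_def using elem_int_integral_shift[OF P(2) int v] by simp
        then show ?case by (simp add: algebra_simps)
      qed
    qed (use \<Psi>_L2[of n v] V E D in \<open>auto simp: L2_01_def\<close>)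
    also have "\<dots> \<le> 2 * error n w + 2 * (\<integral>\<eta>. (?D n \<eta>)\<^sup>2 \<partial>leb01)"
      unfolding error_def by (rule integral_square_add_le[OF E D])
    also have "\<dots> \<le> 2 * error n w + 2 * (1 / Suc n * ?c)"
      by (intro add_left_mono mult_left_mono D_le) simp
    finally show ?thesis .
  qed
  show "(\<lambda>n. \<integral>\<eta>. (\<Psi> (r n) v \<eta> - ?V \<eta>)\<^sup>2 \<partial>leb01) \<longlonglongrightarrow> 0"
  proof (rule tendsto_sandwich[OF _ _ tendsto_const])
    show "\<forall>\<^sub>F n in sequentially. 0 \<le> (\<integral>\<eta>. (\<Psi> (r n) v \<eta> - ?V \<eta>)\<^sup>2 \<partial>leb01)" by simp
    show "\<forall>\<^sub>F n in sequentially. (\<integral>\<eta>. (\<Psi> (r n) v \<eta> - ?V \<eta>)\<^sup>2 \<partial>leb01)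
      \<le> 2 * error (r n) w + 2 * (1 / Suc (r n) * ?c)"
      using le by (intro always_eventually allI)
    have "(\<lambda>n. 1 / real (Suc (r n))) \<longlonglongrightarrow> 0"
      using LIMSEQ_subseq_LIMSEQ[OF LIMSEQ_Suc[OF lim_1_over_n] r(1)] by (simp add: comp_def)
    from tendsto_add[OF tendsto_mult_right_zero[OF r(2), of 2]
      tendsto_mult_right_zero[OF tendsto_mult_left_zero[OF this, of ?c], of 2]]
    show "(\<lambda>n. 2 * error (r n) w + 2 * (1 / Suc (r n) * ?c)) \<longlonglongrightarrow> 0" by simp
  qed
qed

section \<open>The displacement at time 1 and its Gaussian law\<close>

definition drift :: "(real \<Rightarrow> real) \<Rightarrow> real"
  where "drift w = (\<integral>\<eta>. \<Phi> w \<eta> \<partial>leb01)"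

lemma drift_measurable [measurable]: "drift \<in> borel_measurable \<mu>"
proof -
  interpret I: prob_space leb01 by (rule prob_space_leb01)
  show ?thesis unfolding drift_def by measurable
qed

lemma AE_drift_square_le: "AE w in \<mu>. (drift w)\<^sup>2 \<le> (\<integral>\<eta>. (\<Phi> w \<eta>)\<^sup>2 \<partial>leb01)"
  using AE_\<Phi>_L2
proof eventually_elim
  case (elim w)
  interpret I: prob_space leb01 by (rule prob_space_leb01)
  show ?case unfolding drift_def
    using elim by (intro I.expectation_square_le) (auto simp: L2_01_def)
qed

text \<open>Integrating \<Psi>_n over \<eta> only averages its coefficients, so it gives elementary
  integrals. Since [0,1] has mass 1, their squared distance to the drift is at most
  \<open>error n\<close>, and \<open>char_L2_limit\<close> applies.\<close>

lemma drift_gaussian: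
  shows drift_square_integrable: "integrable \<mu> (\<lambda>w. (drift w)\<^sup>2)"
    and char_drift: "char (distr \<mu> borel drift) u = exp (- u\<^sup>2 * expectation (\<lambda>w. (drift w)\<^sup>2) / 2)"
proof -
  interpret I: prob_space leb01 by (rule prob_space_leb01)
  let ?c = "\<lambda>n p. \<integral>\<eta>. g n p \<eta> \<partial>leb01"
  let ?Y = "\<lambda>n. elem_int (P n) (?c n)"
  have [measurable]: "?Y n \<in> borel_measurable \<mu>" for n using P(2) by simp
  have Y: "?Y n w = (\<integral>\<eta>. \<Psi> n w \<eta> \<partial>leb01)" for n w
    unfolding \<Psi>_def elem_int_def
    by (subst Bochner_Integration.integral_sum)
       (auto intro!: integrable_mult_left integrable_bounded_leb01(1)[OF g_measurable g_bound])
  have le: "AE w in \<mu>. (?Y n w - drift w)\<^sup>2 \<le> error n w" for n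
    using AE_\<Phi>_L2
  proof eventually_elim
    case (elim w)
    have E: "(\<lambda>\<eta>. \<Psi> n w \<eta> - \<Phi> w \<eta>) \<in> L2_01" by (rule L2_01_diff[OF \<Psi>_L2 elim])
    have int: "integrable leb01 \<phi>" if "\<phi> \<in> L2_01" for \<phi>
      using that by (auto simp: L2_01_def intro: I.square_integrable_imp_integrable[of \<phi>])
    have "?Y n w - drift w = (\<integral>\<eta>. \<Psi> n w \<eta> - \<Phi> w \<eta> \<partial>leb01)"
      unfolding Y drift_def using int[OF \<Psi>_L2] int[OF elim] by simp
    then show ?case
      using E I.expectation_square_le[of "\<lambda>\<eta>. \<Psi> n w \<eta> - \<Phi> w \<eta>"] by (simp add: L2_01_def error_def)
  qed
  have int: "integrable \<mu> (\<lambda>w. (?Y n w - drift w)\<^sup>2)" for n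
    by (rule Bochner_Integration.integrable_bound[OF error_integrable[of n]])
       (use le[of n] in \<open>auto simp: error_nonneg\<close>)
  \<comment> \<open>The drift is written as Y_0 minus (Y_0 - drift), both square integrable.\<close>
  have "integrable \<mu> (\<lambda>w. (?Y 0 w - (?Y 0 w - drift w))\<^sup>2)"
    using elem_int_square_integral[OF P] int
    by (intro integrable_square_diff[of "?Y 0" _ "\<lambda>w. ?Y 0 w - drift w"]) (auto simp: has_bochner_integral_iff)
  then show drift2: "integrable \<mu> (\<lambda>w. (drift w)\<^sup>2)" by simp
  have "expectation (\<lambda>w. (?Y n w - drift w)\<^sup>2) \<le> 4 / real (Suc n)" for n
    using integral_mono_AE[OF int error_integrable le, of n] error_integral_le[of n] by linarith
  then have lim: "(\<lambda>n. expectation (\<lambda>w. (?Y n w - drift w)\<^sup>2)) \<longlonglongrightarrow> 0"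
    by (intro tendsto_zero_le_inverse_Suc[where c=4]) (simp_all del: of_nat_Suc)
  show "char (distr \<mu> borel drift) u = exp (- u\<^sup>2 * expectation (\<lambda>w. (drift w)\<^sup>2) / 2)"
    by (rule char_L2_limit[OF _ drift2 P int lim]) simp
qed

lemma not_ergodic_if_unitary:
  assumes U: "unitary_01 (\<lambda>f t. f t + kernel_op k f t)"
    and [measurable]: "T \<in> \<mu> \<rightarrow>\<^sub>M \<mu>"
    and T: "AE w in \<mu>. \<forall>t\<in>{0..1}. T w t = w t + (LINT \<eta>:{0..t}|lborel. \<Phi> w \<eta>)"
  shows "\<not> ergodic \<mu> T"
proof
  assume erg: "ergodic \<mu> T"
  show False
  proof (cases "expectation (\<lambda>w. (drift w)\<^sup>2) = 0")
    case True
    then have "AE w in \<mu>. (drift w)\<^sup>2 = 0"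
      using integral_nonneg_eq_0_iff_AE[OF drift_square_integrable] by simp
    with T AE_\<Phi>_L2 have "AE w in \<mu>. T w 1 = w 1"
    proof eventually_elim
      case (elim w)
      have "(LINT \<eta>:{0..1}|lborel. \<Phi> w \<eta>) = drift w"
        unfolding drift_def set_lebesgue_integral_def
        by (subst Bochner_Integration.integral_restrict_space) auto
      with elim show ?case by simp
    qed
    moreover have [measurable]: "(\<lambda>w. w 1) \<in> borel_measurable \<mu>" by simp
    ultimately obtain c where "AE w in \<mu>. w 1 = c"
      using erg unfolding ergodic_def by blast
    then have "AE w in \<mu>. \<bar>w 1\<bar> \<le> \<bar>c\<bar>" by eventually_elim simp
    moreover have "char (distr \<mu> borel (\<lambda>w. w 1)) u = exp (- u\<^sup>2 * 1 / 2)" for u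
    proof -
      \<comment> \<open>The endpoint w(1) is itself an elementary integral, with the single point 1
        and coefficient 1.\<close>
      have "elem_int {1} (\<lambda>_. 1) = (\<lambda>w. w 1)"
        by (simp add: fun_eq_iff elem_singleton)
      moreover have "expectation (\<lambda>w. (w 1)\<^sup>2) = 1"
        using covariance_min[of 1 1] by (simp add: power2_eq_square has_bochner_integral_iff)
      ultimately show ?thesis
        using char_elem_int[of "{1}" "\<lambda>_. 1" u] by simp
    qed
    ultimately show False
      using gaussian_not_bounded[of "\<lambda>w. w 1" 1 "\<bar>c\<bar>"] by simp
  next
    case False
    then have v: "expectation (\<lambda>w. (drift w)\<^sup>2) > 0"
      by (simp add: order_less_le)
    obtain r where r: "strict_mono r" "AE w in \<mu>. (\<lambda>n. error (r n) w) \<longlonglongrightarrow> 0"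
      by (rule AE_error_subsequence)
    txt \<open>
      \<open>\<integral> (\<Phi> w \<eta>)\<^sup>2 d\<eta>\<close> itself cannot be composed with \<open>T\<close> before \<open>T\<close> is known to be
      nonsingular. The version \<open>F\<close> is a limit of functionals that are explicit at every path, so
      that its value at \<open>T w\<close> is computed path by path.
    \<close>
    define F where "F w = lim (\<lambda>n. energy (r n) w)" for w
    have F_measurable: "F \<in> borel_measurable \<mu>" unfolding F_def by measurable
    have F: "AE w in \<mu>. F w = (\<integral>\<eta>. (\<Phi> w \<eta>)\<^sup>2 \<partial>leb01)"
      using AE_\<Phi>_L2 r(2)
    proof eventually_elim
      case (elim w)
      then show ?case unfolding F_def by (intro limI energy_tendsto)
    qed
    have "AE w in \<mu>. F (T w) = F w"
      using AE_\<Phi>_L2 r(2) T F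
    proof eventually_elim
      case (elim w)
      have "(\<lambda>n. energy (r n) (T w)) \<longlonglongrightarrow> (\<integral>\<eta>. (\<Phi> w \<eta> + transpose_op k (\<Phi> w) \<eta>)\<^sup>2 \<partial>leb01)"
        using elim(3) by (intro energy_shift_tendsto[OF elim(1) r(1) elim(2)]) auto
      \<comment> \<open>The limit genuinely exists at T w, so \<open>lim\<close> does not return a
        default there; the isometry of the adjoint removes the transposed term.\<close>
      then have "F (T w) = (\<integral>\<eta>. (\<Phi> w \<eta>)\<^sup>2 \<partial>leb01)"
        unfolding F_def unitary_transpose_isometry[OF k U elim(1)] by (rule limI)
      then show ?case using elim(4) by simp
    qed
    then obtain c where "AE w in \<mu>. F w = c"
      using erg F_measurable unfolding ergodic_def by blast
    with F AE_drift_square_le have "AE w in \<mu>. \<bar>drift w\<bar> \<le> sqrt c"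
      by eventually_elim (auto intro!: real_le_rsqrt)
    then show False
      using gaussian_not_bounded[OF drift_measurable v char_drift] by blast
  qed
qed

end

theorem proposition1:
  fixes \<mu> :: "(real \<Rightarrow> real) measure"
    and k\<^sub>2 :: "real \<Rightarrow> real \<Rightarrow> real"
    and T :: "(real \<Rightarrow> real) \<Rightarrow> real \<Rightarrow> real"
  assumes "wiener_measure \<mu>"
    and "L2_kernel k\<^sub>2"
    and "unitary_01 (\<lambda>f t. f t + kernel_op k\<^sub>2 f t)"
    and "wiener_transformation \<mu> k\<^sub>2 T"
  shows "\<not> ergodic \<mu> T"
proof -
  obtain \<Phi> where \<Phi>: "(\<lambda>(w, \<eta>). \<Phi> w \<eta>) \<in> borel_measurable (\<mu> \<Otimes>\<^sub>M leb01)"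
    "AE \<eta> in leb01. is_wiener_integral \<mu> (\<lambda>s. k\<^sub>2 s \<eta>) (\<lambda>w. \<Phi> w \<eta>)"
    "AE w in \<mu>. \<forall>t\<in>{0..1}. T w t = w t + (LINT \<eta>:{0..t}|lborel. \<Phi> w \<eta>)"
    and T: "T \<in> \<mu> \<rightarrow>\<^sub>M \<mu>"
    using assms(4) unfolding wiener_transformation_def by blast
  show ?thesis
  proof (rule elem_kernel_approximation[OF assms(2)])
    fix P :: "nat \<Rightarrow> real set" and g :: "nat \<Rightarrow> real \<Rightarrow> real \<Rightarrow> real" and C :: "nat \<Rightarrow> real"
    assume approx: "\<And>n. finite (P n)" "\<And>n. P n \<subseteq> {0..1}" "\<And>n p. g n p \<in> borel_measurable leb01"
      "\<And>n p \<eta>. \<bar>g n p \<eta>\<bar> \<le> C n"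
      "\<And>n. L2_kernel (\<lambda>s \<eta>. elem_fun (P n) (\<lambda>p. g n p \<eta>) s - k\<^sub>2 s \<eta>)"
      "\<And>n. (\<integral>x. (case x of (s, \<eta>) \<Rightarrow> (elem_fun (P n) (\<lambda>p. g n p \<eta>) s - k\<^sub>2 s \<eta>)\<^sup>2) \<partial>leb_square) \<le> 1 / Suc n"
    interpret wiener_measure \<mu> by (rule assms(1))
    interpret wiener_integral_approximation \<mu> k\<^sub>2 \<Phi> P g C
      by unfold_locales (fact assms(2) \<Phi>(1,2) approx)+
    show ?thesis by (rule not_ergodic_if_unitary[OF assms(3) T \<Phi>(3)])
  qed
qed

end
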